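(* Let $h$ and $k$ be positive integers with $3 \leq h \leq k-1$, and let $A = \{a_1, \ldots, a_k\}$ be a set of positive integers with $a_1 < \cdots < a_k$. If \[|h^{\wedge}_{\pm}A| = 2hk - h^2 + 1,\] then $A = a_1 \ast \{1, 3, \ldots, 2k-1\}$.
   Context: For a finite set $A = \{a_1, \ldots, a_k\}$ of integers (with distinct $a_i$) and a positive integer $h$, the restricted $h$-fold signed sumset is \[h^{\wedge}_{\pm}A = \left\{ \sum_{i=1}^{k} \lambda_i a_i : \lambda_i \in \{-1,0,1\}, \ \sum_{i=1}^{k} |\lambda_i| = h \right\}.\] For an integer $c$ and a set $S$ of integers, $c \ast S = \{cs : s \in S\}$. *)

theory Defs
  imports Main
begin

definition restricted_signed_sumset :: "nat \<Rightarrow> int set \<Rightarrow> int set" where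
  "restricted_signed_sumset h A =
     {(\<Sum>x\<in>A. l x * x) | l :: int \<Rightarrow> int.
        (\<forall>x\<in>A. l x \<in> {-1, 0, 1}) \<and> (\<Sum>x\<in>A. \<bar>l x\<bar>) = int h}"

definition dilate :: "int \<Rightarrow> int set \<Rightarrow> int set" where
  "dilate c S = {c * s | s. s \<in> S}"

end

theory Submission
  imports Defs
begin

text \<open>
  The sums of \<open>h = k - 1\<close> signed elements are, up to translation by \<open>\<Sum>A\<close>, the numbers \<open>j + 2 \<Sum>I\<close> with
  \<open>j \<in> A\<close> and \<open>I \<subseteq> A - {j}\<close>; call this set \<open>T(A)\<close>. If \<open>n = Max A\<close> and \<open>A' = A - {n}\<close>, then \<open>T(A)\<close> contains
  both \<open>T(A')\<close> and \<open>T(A') + 2 n\<close>, so it exceeds \<open>T(A')\<close> by at least the number of residue classes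
  modulo \<open>2 n\<close> that it meets. There are at least \<open>2 k - 1\<close> such classes: this is easy if \<open>A\<close> contains
  both parities, the even case is halved, and for odd elements one works in \<open>\<int>/n\<close>, where
  \<open>A' \<inter> -A' = {}\<close>. There a set \<open>W\<close> of subset sums that is too small is moved off itself in at most one
  point by every element of \<open>D = A' \<union> -A' \<union> {0}\<close>; double counting forces \<open>D\<close> to be a group and \<open>W\<close> to be
  \<open>D\<close> without one point \<open>g\<close>, which contradicts the size of the subset sums of \<open>A' - {x, y}\<close>, as these avoid
  \<open>g - q\<close> for every near-double sum \<open>q\<close> of \<open>{x, y}\<close>. Induction on \<open>k\<close> then gives \<open>|T(A)| \<ge> k\<^sup>2\<close> for
  \<open>k \<ge> 4\<close>, and in case of equality \<open>A'\<close> is already a progression, so only \<open>n\<close> remains to be determined.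

  For \<open>k \<ge> h + 2\<close>, removing the maximum \<open>n\<close> loses at least \<open>2 h\<close> sums: if \<open>R\<close> is an \<open>h\<close>-subset of \<open>A'\<close> with
  maximal sum, then \<open>n + \<Sum>R - r\<close> for \<open>r \<in> R\<close> and their negatives are new. So equality descends to \<open>A'\<close>.
\<close>

subsection \<open>Subset sums modulo \<open>n\<close>\<close>

text \<open>The case \<open>x = y\<close> of the first clause is deliberate: it excludes
  \<open>n dvd 2 * x\<close>, hence also \<open>n dvd x\<close>. So \<open>X\<close>, its negative
  and 0 give \<open>2 * card X + 1\<close> different residues, which are collected in
  \<open>sym_residues\<close>.\<close>

definition antisym_mod :: "int \<Rightarrow> int set \<Rightarrow> bool" where
  "antisym_mod n X \<longleftrightarrow> (\<forall>x\<in>X. \<forall>y\<in>X. \<not> n dvd x + y \<and> (x \<noteq> y \<longrightarrow> \<not> n dvd x - y))"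

definition subset_sums_mod :: "int \<Rightarrow> int set \<Rightarrow> int set" where
  "subset_sums_mod n X = (\<lambda>I. \<Sum>I mod n) ` Pow X"

definition sym_residues :: "int \<Rightarrow> int set \<Rightarrow> int set" where
  "sym_residues n X = insert 0 ((\<lambda>x. x mod n) ` X \<union> (\<lambda>x. (- x) mod n) ` X)"

lemma antisym_mod_subset: "antisym_mod n X \<Longrightarrow> Y \<subseteq> X \<Longrightarrow> antisym_mod n Y"
  unfolding antisym_mod_def by blast

lemma antisym_modD:
  assumes "antisym_mod n X" "x \<in> X" "y \<in> X"
  shows "\<not> n dvd x + y" and "n dvd x - y \<Longrightarrow> x = y"
  using assms unfolding antisym_mod_def by auto

lemma antisym_mod_not_dvd:
  assumes "antisym_mod n X" "x \<in> X" shows "\<not> n dvd x"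
  using assms unfolding antisym_mod_def by (metis dvd_add)

lemma inj_on_mod_antisym_mod:
  assumes "antisym_mod n X"
  shows "inj_on (\<lambda>x. x mod n) X"
  using assms unfolding inj_on_def antisym_mod_def mod_eq_dvd_iff by blast

lemma zero_notin_mod_antisym_mod:
  assumes "antisym_mod n X"
  shows "0 \<notin> (\<lambda>x. x mod n) ` X"
proof
  assume "0 \<in> (\<lambda>x. x mod n) ` X"
  then obtain x where "x \<in> X" "x mod n = 0" by force
  then show False using antisym_mod_not_dvd[OF assms] by (simp add: dvd_eq_mod_eq_0)
qed

lemma card_sym_residues:
  assumes "finite X" "antisym_mod n X"
  shows "card (sym_residues n X) = 2 * card X + 1"
proof -
  let ?P = "(\<lambda>x. x mod n) ` X" and ?M = "(\<lambda>x. (- x) mod n) ` X"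
  have i2: "inj_on (\<lambda>x. (- x) mod n) X"
  proof (rule inj_onI)
    fix x y assume xy: "x \<in> X" "y \<in> X" and "(- x) mod n = (- y) mod n"
    then have "n dvd y - x" unfolding mod_eq_dvd_iff by simp
    then show "x = y" using antisym_modD(2)[OF assms(2) xy(2,1)] by simp
  qed
  have dj: "?P \<inter> ?M = {}"
  proof (rule ccontr)
    assume "?P \<inter> ?M \<noteq> {}"
    then obtain x y where xy: "x \<in> X" "y \<in> X" "x mod n = (- y) mod n" by auto
    then have "n dvd x + y" unfolding mod_eq_dvd_iff by simp
    then show False using antisym_modD(1)[OF assms(2) xy(1,2)] by simp
  qed
  have "0 \<notin> ?M"
  proof
    assume "0 \<in> ?M"
    then obtain x where "x \<in> X" "(- x) mod n = 0" by force
    then show False using antisym_mod_not_dvd[OF assms(2)] dvd_eq_mod_eq_0[of n "- x"] by simp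
  qed
  then have z: "0 \<notin> ?P \<union> ?M" using zero_notin_mod_antisym_mod[OF assms(2)] by blast
  have "card (?P \<union> ?M) = card X + card X"
    using assms(1) card_image[OF inj_on_mod_antisym_mod[OF assms(2)]] card_image[OF i2]
    by (subst card_Un_disjoint[OF _ _ dj]) auto
  then show ?thesis unfolding sym_residues_def
    using assms(1) card_insert_disjoint[OF _ z] by simp
qed

lemma sum_subset_remove_cases:
  fixes X :: "int set"
  assumes "finite X" "x \<in> X" "I \<subseteq> X"
  obtains "I \<subseteq> X - {x}" | J where "J \<subseteq> X - {x}" "I = insert x J" "\<Sum>I = \<Sum>J + x"
proof (cases "x \<in> I")
  case True
  have "finite I" using assms finite_subset by blast
  then have "\<Sum>I = \<Sum>(I - {x}) + x" using True by (simp add: sum.remove[of I x])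
  then show ?thesis using that(2)[of "I - {x}"] True assms(3) by blast
next
  case False then show ?thesis using that(1) assms(3) by blast
qed

lemma sum_insert_subset:
  fixes X :: "int set"
  assumes "finite X" "x \<in> X" "J \<subseteq> X - {x}"
  shows "\<Sum>(insert x J) = \<Sum>J + x"
proof -
  have "finite J" "x \<notin> J" using assms finite_subset by auto
  then show ?thesis by simp
qed

section \<open>Counting how often translations move a set of residues off itself\<close>

definition exits :: "int \<Rightarrow> int set \<Rightarrow> int \<Rightarrow> int set" where
  "exits n B d = {b \<in> B. (b + d) mod n \<notin> B}"

lemma finite_exits: "finite B \<Longrightarrow> finite (exits n B d)"
  unfolding exits_def by simp

lemma exits_mod: "exits n B (d mod n) = exits n B d"
  unfolding exits_def by (simp add: mod_simps)

text \<open>Translation by \<open>d\<close> maps the points of \<open>B\<close> that stay in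
  \<open>B\<close> under \<open>d\<close> bijectively onto those that stay under \<open>- d\<close>.
  The complements in \<open>B\<close> therefore have equal size.\<close>

lemma card_exits_minus:
  assumes "finite B" "B \<subseteq> {0..<n}"
  shows "card (exits n B (- d)) = card (exits n B d)"
proof -
  let ?P = "{b \<in> B. (b + d) mod n \<in> B}" and ?M = "{b \<in> B. (b + - d) mod n \<in> B}"
  have "bij_betw (\<lambda>b. (b + d) mod n) ?P ?M"
  proof (rule bij_betw_byWitness[where f' = "\<lambda>b. (b + - d) mod n"])
    show "\<forall>a\<in>?P. ((a + d) mod n + - d) mod n = a" using assms(2) by (auto simp: mod_simps)
    show "\<forall>a\<in>?M. ((a + - d) mod n + d) mod n = a" using assms(2) by (auto simp: mod_simps)
    show "(\<lambda>b. (b + d) mod n) ` ?P \<subseteq> ?M" using assms(2) by (auto simp: mod_simps)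
    show "(\<lambda>b. (b + - d) mod n) ` ?M \<subseteq> ?P" using assms(2) by (auto simp: mod_simps)
  qed
  then have e: "card ?P = card ?M" by (rule bij_betw_same_card)
  have "exits n B d = B - ?P" "exits n B (- d) = B - ?M" unfolding exits_def by auto
  then show ?thesis using e assms(1) by (simp add: card_Diff_subset)
qed

lemma sum_card_exits:
  assumes "finite B" "finite D"
  shows "(\<Sum>b\<in>B. card {d\<in>D. (b + d) mod n \<notin> B}) = (\<Sum>d\<in>D. card (exits n B d))"
proof -
  have "(\<Sum>b\<in>B. card {d\<in>D. (b + d) mod n \<notin> B})
      = (\<Sum>b\<in>B. \<Sum>d\<in>D. if (b + d) mod n \<notin> B then 1 else 0)"
    using assms(2) by (simp only: card_eq_sum sum.inter_filter)
  also have "\<dots> = (\<Sum>d\<in>D. \<Sum>b\<in>B. if (b + d) mod n \<notin> B then 1 else 0)" by (rule sum.swap)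
  also have "\<dots> = (\<Sum>d\<in>D. card (exits n B d))"
    unfolding exits_def using assms(1) by (simp only: card_eq_sum sum.inter_filter)
  finally show ?thesis .
qed

text \<open>The hypothesis on \<open>X\<close> passes to the negatives by
  \<open>card_exits_minus\<close>, and translation by 0 moves nothing out. Only the
  \<open>2 * card X\<close> nonzero elements of \<open>sym_residues n X\<close> contribute to the
  double count, each at most 1.\<close>

lemma sum_card_exits_le:
  assumes "finite B" "B \<subseteq> {0..<n}" "finite X" "antisym_mod n X"
    and one: "\<And>x. x \<in> X \<Longrightarrow> card (exits n B x) \<le> 1"
  shows "(\<Sum>b\<in>B. card {d\<in>sym_residues n X. (b + d) mod n \<notin> B}) \<le> 2 * card X"
    and "d \<in> sym_residues n X \<Longrightarrow> card (exits n B d) \<le> 1"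
proof -
  let ?D = "sym_residues n X"
  have fin: "finite ?D" unfolding sym_residues_def using assms(3) by simp
  have le: "card (exits n B d) \<le> 1" if "d \<in> ?D" "d \<noteq> 0" for d
    using that one assms(1,2) unfolding sym_residues_def
    by (auto simp: exits_mod card_exits_minus)
  have z: "exits n B 0 = {}" unfolding exits_def using assms(2) by auto
  have "(\<Sum>d\<in>?D. card (exits n B d)) = (\<Sum>d\<in>?D - {0}. card (exits n B d))"
    using fin z by (intro sum.mono_neutral_right) auto
  also have "\<dots> \<le> (\<Sum>d\<in>?D - {0}. 1)" by (intro sum_mono) (use le in auto)
  also have "\<dots> = 2 * card X"
  proof -
    have "0 \<in> ?D" unfolding sym_residues_def by simp
    then show ?thesis using card_sym_residues[OF assms(3,4)] fin by simp
  qed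
  finally show "(\<Sum>b\<in>B. card {d\<in>?D. (b + d) mod n \<notin> B}) \<le> 2 * card X"
    using sum_card_exits[OF assms(1) fin] by simp
  show "card (exits n B d) \<le> 1" if "d \<in> ?D" using le[OF that] z by (cases "d = 0") auto
qed

text \<open>For fixed \<open>b\<close>, different \<open>d\<close> in \<open>{0..<n}\<close> give
  different translates, so at most \<open>card B\<close> of them land in \<open>B\<close>. A set
  \<open>D\<close> larger than \<open>B\<close> thus forces exits at every point.\<close>

lemma card_translates_outside:
  fixes n :: int
  assumes "finite B" "finite D" "D \<subseteq> {0..<n}"
  shows "card D \<le> card {d\<in>D. (b + d) mod n \<notin> B} + card {d\<in>D. (b + d) mod n \<in> B}"
    and "card {d\<in>D. (b + d) mod n \<in> B} \<le> card B"
proof -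
  have "D = {d\<in>D. (b + d) mod n \<notin> B} \<union> {d\<in>D. (b + d) mod n \<in> B}" by auto
  then show "card D \<le> card {d\<in>D. (b + d) mod n \<notin> B} + card {d\<in>D. (b + d) mod n \<in> B}"
    using card_Un_le[of "{d\<in>D. (b + d) mod n \<notin> B}" "{d\<in>D. (b + d) mod n \<in> B}"] by simp
  have "inj_on (\<lambda>d. (b + d) mod n) {d\<in>D. (b + d) mod n \<in> B}"
  proof (rule inj_onI)
    fix u v assume u: "u \<in> {d\<in>D. (b + d) mod n \<in> B}" and v: "v \<in> {d\<in>D. (b + d) mod n \<in> B}"
      and e: "(b + u) mod n = (b + v) mod n"
    have "u mod n = v mod n" using e unfolding mod_eq_dvd_iff by simp
    then show "u = v" using u v assms(3) by (auto simp: subset_iff)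
  qed
  then show "card {d\<in>D. (b + d) mod n \<in> B} \<le> card B"
    using assms(1) by (intro card_inj_on_le) auto
qed

lemma sym_residues_range: "n > 0 \<Longrightarrow> sym_residues n X \<subseteq> {0..<n}"
  unfolding sym_residues_def by auto

text \<open>If the sums were fewer than \<open>2 * card X\<close>, then by induction the omission of
  \<open>x\<close> loses at most one of them, so \<open>x\<close> moves at most one point out. But
  each point has at least \<open>(2 * card X + 1) - (2 * card X - 1) = 2\<close> exits, so double
  counting leaves at most \<open>card X\<close> sums, fewer than 0 and the elements of
  \<open>X\<close> already provide.\<close>

lemma card_subset_sums_mod_ge:
  assumes "n > 0" "finite X" "antisym_mod n X"
  shows "2 * card X \<le> card (subset_sums_mod n X)"
  using assms(2,3)
proof (induction "card X" arbitrary: X)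
  case 0 then show ?case by simp
next
  case (Suc m)
  let ?B = "subset_sums_mod n X" and ?D = "sym_residues n X"
  have fB: "finite ?B" unfolding subset_sums_mod_def using Suc.prems by simp
  have rB: "?B \<subseteq> {0..<n}" unfolding subset_sums_mod_def using assms(1) by auto
  have fD: "finite ?D" unfolding sym_residues_def using Suc.prems by simp
  show ?case
  proof (rule ccontr)
    assume "\<not> ?thesis"
    then have small: "card ?B < 2 * card X" by simp
    have one: "card (exits n ?B x) \<le> 1" if x: "x \<in> X" for x
    proof -
      let ?C = "subset_sums_mod n (X - {x})"
      have CB: "?C \<subseteq> ?B" unfolding subset_sums_mod_def by auto
      have CxB: "(c + x) mod n \<in> ?B" if "c \<in> ?C" for c
      proof -
        obtain J where J: "J \<subseteq> X - {x}" "c = \<Sum>J mod n"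
          using \<open>c \<in> ?C\<close> unfolding subset_sums_mod_def by auto
        have "(c + x) mod n = \<Sum>(insert x J) mod n"
          using sum_insert_subset[OF Suc.prems(1) x J(1)] J(2) by (simp add: mod_simps)
        then show ?thesis unfolding subset_sums_mod_def using J(1) x by auto
      qed
      have "2 * m \<le> card ?C"
      proof -
        have "card (X - {x}) = m" using Suc.hyps(2) Suc.prems(1) x by simp
        then show ?thesis
          using Suc.hyps(1)[of "X - {x}"] Suc.prems antisym_mod_subset[of n X "X - {x}"] by auto
      qed
      then have "card (?B - ?C) \<le> 1"
        using small Suc.hyps(2) CB fB by (simp add: card_Diff_subset finite_subset)
      moreover have "exits n ?B x \<subseteq> ?B - ?C" unfolding exits_def using CxB by auto
      ultimately show ?thesis using card_mono[of "?B - ?C" "exits n ?B x"] fB by simp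
    qed
    have two: "2 \<le> card {d\<in>?D. (b + d) mod n \<notin> ?B}" for b
      using card_translates_outside[OF fB fD sym_residues_range[OF assms(1)], where b = b] small
        card_sym_residues[OF Suc.prems] by linarith
    have "(\<Sum>b\<in>?B. 2) \<le> (\<Sum>b\<in>?B. card {d\<in>?D. (b + d) mod n \<notin> ?B})"
      using two by (intro sum_mono)
    then have "card ?B \<le> card X"
      using sum_card_exits_le(1)[OF fB rB Suc.prems one] by simp
    moreover have "card X + 1 \<le> card ?B"
    proof -
      have "card (insert 0 ((\<lambda>x. x mod n) ` X)) = card X + 1"
        using Suc.prems(1) card_image[OF inj_on_mod_antisym_mod[OF Suc.prems(2)]]
          zero_notin_mod_antisym_mod[OF Suc.prems(2)] by simp
      moreover have "insert 0 ((\<lambda>x. x mod n) ` X) \<subseteq> ?B"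
      proof -
        have "0 \<in> ?B" unfolding subset_sums_mod_def by (rule image_eqI[of _ _ "{}"]) auto
        moreover have "x mod n \<in> ?B" if "x \<in> X" for x
          unfolding subset_sums_mod_def by (rule image_eqI[of _ _ "{x}"]) (use that in auto)
        ultimately show ?thesis by auto
      qed
      ultimately show ?thesis using card_mono[OF fB, of "insert 0 ((\<lambda>x. x mod n) ` X)"] by simp
    qed
    ultimately show False by simp
  qed
qed

section \<open>Doubled subset sums modulo an odd number\<close>

definition double_sums_mod :: "int \<Rightarrow> int set \<Rightarrow> int set" where
  "double_sums_mod n X = (\<lambda>I. 2 * \<Sum>I mod n) ` Pow X"

text \<open>The value \<open>j = 0\<close> stands for the modulus \<open>n\<close> itself: it is
  what remains modulo \<open>n\<close> when the maximum \<open>n\<close> is the omitted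
  element.\<close>

definition near_double_sums_mod :: "int \<Rightarrow> int set \<Rightarrow> int set" where
  "near_double_sums_mod n X = {(2 * \<Sum>I + j) mod n | I j. I \<subseteq> X \<and> j \<in> insert 0 (X - I)}"

lemma odd_dvd_two_mult: "odd (n::int) \<Longrightarrow> n dvd 2 * x \<longleftrightarrow> n dvd x"
  by (simp add: coprime_dvd_mult_right_iff)

text \<open>Doubling is injective on residues modulo an odd number, so the bound for subset sums
  carries over.\<close>

lemma card_double_sums_mod_ge:
  assumes "n > 0" "odd n" "finite X" "antisym_mod n X"
  shows "2 * card X \<le> card (double_sums_mod n X)"
proof -
  have "double_sums_mod n X = (\<lambda>s. 2 * s mod n) ` subset_sums_mod n X"
    unfolding double_sums_mod_def subset_sums_mod_def by (simp add: image_image mod_simps)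
  moreover have "inj_on (\<lambda>s. 2 * s mod n) (subset_sums_mod n X)"
  proof (rule inj_onI)
    fix s t assume st: "s \<in> subset_sums_mod n X" "t \<in> subset_sums_mod n X"
      and "2 * s mod n = 2 * t mod n"
    then have "n dvd 2 * (s - t)" unfolding mod_eq_dvd_iff by (simp add: right_diff_distrib)
    then have "s mod n = t mod n" using odd_dvd_two_mult[OF assms(2)] unfolding mod_eq_dvd_iff by blast
    then show "s = t" using st unfolding subset_sums_mod_def by auto
  qed
  ultimately show ?thesis using card_subset_sums_mod_ge[OF assms(1,3,4)] by (simp add: card_image)
qed

text \<open>The summand \<open>j\<close> improves the bound for doubled sums by one, since otherwise
  both sets coincide and become too rigid to exist. Two elements are not enough:
  \<open>n = 5\<close> and \<open>X = {1, 3}\<close> give only the residues 0, 1, 2, 3.\<close>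

lemma card_near_double_sums_mod_ge:
  assumes n: "n > 0" "odd n" and X: "finite X" "antisym_mod n X" and m: "3 \<le> card X"
  shows "2 * card X + 1 \<le> card (near_double_sums_mod n X)"
proof (rule ccontr)
  let ?Y = "near_double_sums_mod n X" and ?W = "double_sums_mod n X" and ?D = "sym_residues n X"
  let ?m = "card X"
  assume "\<not> ?thesis"
  then have small: "card ?Y \<le> 2 * ?m" by simp
  have rY: "?Y \<subseteq> {0..<n}" unfolding near_double_sums_mod_def using n(1) by auto
  then have fY: "finite ?Y" by (rule finite_subset) simp
  have fD: "finite ?D" unfolding sym_residues_def using X(1) by simp
  have rD: "?D \<subseteq> {0..<n}" using sym_residues_range[OF n(1)] .
  have Y_I: "(2 * \<Sum>I + j) mod n \<in> ?Y" if "I \<subseteq> X" "j \<in> insert 0 (X - I)" for I j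
    unfolding near_double_sums_mod_def using that by blast
  have "?W \<subseteq> ?Y"
  proof
    fix w assume "w \<in> ?W"
    then obtain I where "I \<subseteq> X" "w = 2 * \<Sum>I mod n" unfolding double_sums_mod_def by auto
    then show "w \<in> ?Y" using Y_I[of I 0] by simp
  qed
  moreover have "2 * ?m \<le> card ?W" using card_double_sums_mod_ge[OF n X] .
  \<comment> \<open>The equality \<open>?W = ?Y\<close> lets steps by \<open>x\<close>, and not only
    by \<open>2 * x\<close>, lead from sums avoiding \<open>x\<close> back into
    \<open>?W\<close>.\<close>
  ultimately have WY: "?W = ?Y" and cW: "card ?W = 2 * ?m"
    using small card_seteq[OF fY] card_mono[OF fY, of ?W] by auto
  have fW: "finite ?W" and rW: "?W \<subseteq> {0..<n}" using WY fY rY by auto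
  have W_I: "(2 * \<Sum>I + j) mod n \<in> ?W" if "I \<subseteq> X" "j \<in> insert 0 (X - I)" for I j
    using Y_I[OF that] WY by simp
  have nd: "\<not> n dvd x" if "x \<in> X" for x using antisym_mod_not_dvd[OF X(2) that] .
  \<comment> \<open>If \<open>x\<close> moved two points out, these would be all of
    \<open>?W - ?C\<close>, and subtracting \<open>x\<close> would swap them. Then
    \<open>2 * x\<close> would vanish modulo the odd \<open>n\<close>.\<close>
  have one: "card (exits n ?W x) \<le> 1" if x: "x \<in> X" for x
  proof (rule ccontr)
    let ?C = "double_sums_mod n (X - {x})"
    assume big: "\<not> card (exits n ?W x) \<le> 1"
    have CW: "?C \<subseteq> ?W" unfolding double_sums_mod_def by auto
    have Cx: "(c + x) mod n \<in> ?W" "(c + 2 * x) mod n \<in> ?W" if "c \<in> ?C" for c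
    proof -
      obtain J where J: "J \<subseteq> X - {x}" "c = 2 * \<Sum>J mod n"
        using \<open>c \<in> ?C\<close> unfolding double_sums_mod_def by auto
      have "(c + x) mod n = (2 * \<Sum>J + x) mod n" using J(2) by (simp add: mod_simps)
      then show "(c + x) mod n \<in> ?W" using W_I[of J x] J(1) x by auto
      have "(c + 2 * x) mod n = (2 * \<Sum>(insert x J) + 0) mod n"
        using sum_insert_subset[OF X(1) x J(1)] J(2) by (simp add: mod_simps algebra_simps)
      then show "(c + 2 * x) mod n \<in> ?W" using W_I[of "insert x J" 0] J(1) x by auto
    qed
    have W_cases: "w \<in> ?C \<or> (\<exists>c\<in>?C. w = (c + 2 * x) mod n)" if w: "w \<in> ?W" for w
    proof -
      obtain I where I: "I \<subseteq> X" "w = 2 * \<Sum>I mod n" using w unfolding double_sums_mod_def by auto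
      show ?thesis using X(1) x I(1)
      proof (cases rule: sum_subset_remove_cases)
        case 1 then show ?thesis using I(2) unfolding double_sums_mod_def by auto
      next
        case (2 J)
        then have "w = (2 * \<Sum>J mod n + 2 * x) mod n" using I(2) by (simp add: mod_simps algebra_simps)
        moreover have "2 * \<Sum>J mod n \<in> ?C" using 2(1) unfolding double_sums_mod_def by auto
        ultimately show ?thesis by blast
      qed
    qed
    have "2 * card (X - {x}) \<le> card ?C"
      using card_double_sums_mod_ge[OF n, of "X - {x}"] X antisym_mod_subset[of n X "X - {x}"] by auto
    then have "2 * ?m - 2 \<le> card ?C" using x X(1) by simp
    then have cE: "card (?W - ?C) \<le> 2"
      using cW CW fW by (simp add: card_Diff_subset finite_subset)
    have EE: "exits n ?W x \<subseteq> ?W - ?C" unfolding exits_def using Cx by auto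
    have "2 \<le> card (exits n ?W x)" using big by simp
    then have eq: "exits n ?W x = ?W - ?C" and c2: "card (?W - ?C) = 2"
      using card_seteq[OF _ EE] card_mono[OF _ EE] fW cE by auto
    have step: "(e - x) mod n \<in> ?W - ?C" if e: "e \<in> ?W - ?C" for e
    proof -
      obtain c where c: "c \<in> ?C" "e = (c + 2 * x) mod n" using W_cases e by blast
      have e2: "(e - x) mod n = (c + x) mod n" using c(2) by (simp add: mod_simps add.commute)
      then have "(e - x) mod n \<in> ?W" using Cx(1)[OF c(1)] by simp
      \<comment> \<open>Elements of \<open>?C\<close> stay in \<open>?W\<close> when
        \<open>2 * x\<close> is added, so \<open>e - x\<close> in \<open>?C\<close> would put
        \<open>e + x\<close> into \<open>?W\<close>, although \<open>e\<close> exits under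
        \<open>x\<close>.\<close>
      moreover have "(e - x) mod n \<notin> ?C"
      proof
        assume "(e - x) mod n \<in> ?C"
        then have "((e - x) mod n + 2 * x) mod n \<in> ?W" by (rule Cx(2))
        then have "(e + x) mod n \<in> ?W" by (simp add: mod_simps add.commute)
        moreover have "e \<in> exits n ?W x" using e eq by simp
        ultimately show False unfolding exits_def by simp
      qed
      ultimately show ?thesis by simp
    qed
    obtain e1 e2 where e: "?W - ?C = {e1, e2}" "e1 \<noteq> e2" using c2 by (meson card_2_iff)
    have r: "e1 mod n = e1" "e2 mod n = e2" using e rW by (auto simp: subset_iff)
    have ne: "(v - x) mod n \<noteq> v mod n" for v using nd[OF x] unfolding mod_eq_dvd_iff by simp
    have "(e1 - x) mod n = e2" "(e2 - x) mod n = e1"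
      using step[of e1] step[of e2] e ne[of e1] ne[of e2] r by auto
    then have "(e1 - x - x) mod n = e1 mod n" using r by (metis mod_diff_left_eq)
    then have "n dvd 2 * x" unfolding mod_eq_dvd_iff by simp
    then show False using nd[OF x] odd_dvd_two_mult[OF n(2)] by blast
  qed
  \<comment> \<open>Each point has at least \<open>(2 * ?m + 1) - 2 * ?m = 1\<close> exit, while the
    total over the \<open>2 * ?m\<close> points is at most \<open>2 * ?m\<close>. So no point can
    have two.\<close>
  have out_le: "card {d\<in>?D. (w + d) mod n \<notin> ?W} \<le> 1" if "w \<in> ?W" for w
  proof (rule ccontr)
    let ?f = "\<lambda>w. card {d\<in>?D. (w + d) mod n \<notin> ?W}"
    assume "\<not> ?f w \<le> 1"
    then have "2 \<le> ?f w" by simp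
    moreover have ge1: "1 \<le> ?f v" for v
      using card_translates_outside[OF fW fD rD, where b = v] cW card_sym_residues[OF X] by linarith
    moreover have "(\<Sum>v\<in>?W. ?f v) = ?f w + (\<Sum>v\<in>?W - {w}. ?f v)" using fW that by (rule sum.remove)
    moreover have "(\<Sum>v\<in>?W - {w}. 1) \<le> (\<Sum>v\<in>?W - {w}. ?f v)" by (intro sum_mono ge1)
    moreover have "(\<Sum>v\<in>?W - {w}. 1) = 2 * ?m - 1" using fW that cW by simp
    ultimately show False using sum_card_exits_le(1)[OF fW rW X one] m by linarith
  qed
  \<comment> \<open>At least \<open>2 * ?m\<close> of the translates of \<open>w\<close> by
    \<open>?D\<close> stay in \<open>?W\<close>. This is the size of \<open>?W\<close>, so they fill
    it.\<close>
  have diff_D: "(v - w) mod n \<in> ?D" if v: "v \<in> ?W" and w: "w \<in> ?W" for v w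
  proof -
    let ?S = "{d\<in>?D. (w + d) mod n \<in> ?W}"
    have "2 * ?m \<le> card ?S"
      using out_le[OF w] card_translates_outside(1)[OF fW fD rD, where b = w] card_sym_residues[OF X] by linarith
    moreover have inj: "inj_on (\<lambda>d. (w + d) mod n) ?S"
    proof (rule inj_onI)
      fix p q assume pq: "p \<in> ?S" "q \<in> ?S" and "(w + p) mod n = (w + q) mod n"
      then have "p mod n = q mod n" unfolding mod_eq_dvd_iff by simp
      then show "p = q" using pq rD by (auto simp: subset_iff)
    qed
    ultimately have "(\<lambda>d. (w + d) mod n) ` ?S = ?W"
      using cW fW by (intro card_seteq) (auto simp: card_image)
    then obtain d where d: "d \<in> ?D" "v = (w + d) mod n" using v by auto
    then have "(v - w) mod n = d mod n" by (simp add: mod_simps)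
    then show ?thesis using d(1) rD by (auto simp: subset_iff)
  qed
  \<comment> \<open>At most two points \<open>w\<close> of \<open>?W\<close> have
    \<open>w + p\<close> or \<open>w + p + q\<close> outside \<open>?W\<close>. Any of the remaining
    ones shows \<open>p + q\<close> as a difference of two elements of \<open>?W\<close>.\<close>
  have D_add: "(p + q) mod n \<in> ?D" if p: "p \<in> ?D" and q: "q \<in> ?D" for p q
  proof -
    let ?F = "{w\<in>?W. (w + p) mod n \<in> ?W \<and> (w + p + q) mod n \<notin> ?W}"
    have 1: "card (exits n ?W p) \<le> 1" "card (exits n ?W q) \<le> 1"
      using sum_card_exits_le(2)[OF fW rW X one] p q by auto
    have "card ?F \<le> card (exits n ?W q)"
    proof (rule card_inj_on_le[where f = "\<lambda>w. (w + p) mod n"])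
      show "inj_on (\<lambda>w. (w + p) mod n) ?F"
      proof (rule inj_onI)
        fix u v assume uv: "u \<in> ?F" "v \<in> ?F" and "(u + p) mod n = (v + p) mod n"
        then have "u mod n = v mod n" unfolding mod_eq_dvd_iff by simp
        then show "u = v" using uv rW by (auto simp: subset_iff)
      qed
      show "(\<lambda>w. (w + p) mod n) ` ?F \<subseteq> exits n ?W q" unfolding exits_def by (auto simp: mod_simps)
      show "finite (exits n ?W q)" by (rule finite_exits[OF fW])
    qed
    then have "card (exits n ?W p \<union> ?F) \<le> 2" using 1 card_Un_le[of "exits n ?W p" ?F] by linarith
    then have "\<not> ?W \<subseteq> exits n ?W p \<union> ?F"
      using card_mono[of "exits n ?W p \<union> ?F" ?W] finite_exits[OF fW, of n p] fW cW m by auto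
    then obtain w where w: "w \<in> ?W" "(w + p + q) mod n \<in> ?W" unfolding exits_def by auto
    have "((w + p + q) mod n - w) mod n = (p + q) mod n" by (simp add: mod_simps)
    then show ?thesis using diff_D[OF w(2,1)] by simp
  qed
  have D_diff: "(u - v) mod n \<in> ?D" if u: "u mod n \<in> ?D" and v: "v mod n \<in> ?D" for u v
  proof -
    have "(- v) mod n \<in> ?D"
    proof -
      consider "v mod n = 0" | x where "x \<in> X" "v mod n = x mod n" | x where "x \<in> X" "v mod n = (- x) mod n"
        using v unfolding sym_residues_def by auto
      then show ?thesis
      proof cases
        case 1 then show ?thesis unfolding sym_residues_def by (simp add: mod_eq_0_iff_dvd)
      next
        case 2 then have "(- v) mod n = (- x) mod n" by (metis mod_minus_eq)
        then show ?thesis using 2(1) unfolding sym_residues_def by auto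
      next
        case 3 then have "(- v) mod n = x mod n" by (metis mod_minus_eq minus_minus)
        then show ?thesis using 3(1) unfolding sym_residues_def by auto
      qed
    qed
    from D_add[OF u this] show ?thesis by (simp add: mod_simps)
  qed
  have z_W: "0 \<in> ?W" using W_I[of "{}" 0] by simp
  have WD: "?W \<subseteq> ?D"
  proof
    fix w assume w: "w \<in> ?W"
    then have "w mod n = w" using rW by (auto simp: subset_iff)
    then show "w \<in> ?D" using diff_D[OF w z_W] by simp
  qed
  have "card (?D - ?W) = 1" using WD fW cW card_sym_residues[OF X] by (simp add: card_Diff_subset)
  then obtain g where g: "g \<in> ?D" "g \<notin> ?W" by (metis card_1_singletonE Diff_iff singletonI)
  obtain x where x: "x \<in> X" using m by fastforce
  \<comment> \<open>Up to sign at most one element of \<open>X\<close> is congruent to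
    \<open>2 * x\<close>, and \<open>X - {x}\<close> has at least two elements. The choice of
    \<open>y\<close> keeps the entries of \<open>?Q\<close> below distinct modulo
    \<open>n\<close>.\<close>
  have "\<exists>y\<in>X - {x}. \<not> n dvd 2 * x - y \<and> \<not> n dvd 2 * x + y"
  proof (rule ccontr)
    assume H: "\<not> ?thesis"
    have "y = z" if y: "y \<in> X - {x}" and z: "z \<in> X - {x}" for y z
    proof (rule ccontr)
      assume yz: "y \<noteq> z"
      have "n dvd 2 * x - y \<or> n dvd 2 * x + y" "n dvd 2 * x - z \<or> n dvd 2 * x + z" using H y z by auto
      moreover have "y - z = (2*x - z) - (2*x - y)" "y + z = (2*x + z) - (2*x - y)"
         "y + z = (2*x + y) - (2*x - z)" "y - z = (2*x + y) - (2*x + z)" by auto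
      ultimately have "n dvd y - z \<or> n dvd y + z" by (metis dvd_diff)
      then show False using antisym_modD[OF X(2), of y z] y z yz by auto
    qed
    then have "card (X - {x}) \<le> 1" using X(1) by (simp add: card_le_Suc0_iff_eq)
    then show False using m x X(1) by simp
  qed
  then obtain y where y: "y \<in> X" "y \<noteq> x" "\<not> n dvd 2 * x - y" "\<not> n dvd 2 * x + y" by blast
  \<comment> \<open>\<open>?Q\<close> lists the near-double sums of \<open>{x, y}\<close> except
    \<open>x\<close> and \<open>x + 2 * y\<close>, whose distinctness from the others would need
    further conditions. A doubled sum over \<open>?Z\<close> plus an element of \<open>?Q\<close>
    lies in \<open>?W\<close>, so it is never \<open>g\<close>. Hence \<open>?C\<close> and
    \<open>?G\<close> are disjoint in \<open>?D\<close>, but \<open>2 * (?m - 2) + 6\<close> exceeds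
    \<open>2 * ?m + 1\<close>.\<close>
  let ?Z = "X - {x, y}" and ?Q = "[0, y, 2 * x, 2 * y, 2 * x + y, 2 * x + 2 * y]"
  let ?C = "double_sums_mod n ?Z" and ?G = "(\<lambda>q. (g - q) mod n) ` set ?Q"
  have nd2: "\<not> n dvd v \<Longrightarrow> \<not> n dvd 2 * v" for v using odd_dvd_two_mult[OF n(2)] by blast
  have xy: "\<not> n dvd x" "\<not> n dvd y" "\<not> n dvd x - y" "\<not> n dvd x + y"
    using nd x y antisym_modD[OF X(2) x y(1)] by auto
  note nds = xy y(3,4) nd2[OF xy(1)] nd2[OF xy(2)] nd2[OF xy(3)] nd2[OF xy(4)]
  have distQ: "inj_on (\<lambda>q. (g - q) mod n) (set ?Q)" and cQ: "card (set ?Q) = 6"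
  proof -
    have *: "\<not> n dvd u - v" if "u \<in> set ?Q" "v \<in> set ?Q" "u \<noteq> v" for u v
    proof -
      \<comment> \<open>These are the differences of distinct elements of \<open>?Q\<close>, up to
        sign.\<close>
      let ?L = "{y, 2 * x, 2 * y, 2 * x + y, 2 * (x + y), 2 * x - y, 2 * (x - y)}"
      have L: "\<not> n dvd w" if "w \<in> ?L" for w using that nds by blast
      have "u - v \<in> ?L \<or> v - u \<in> ?L" using that by (simp, elim disjE; simp)
      then show ?thesis using L[of "u - v"] L[of "v - u"] dvd_diff_commute[of n u v] by blast
    qed
    show "inj_on (\<lambda>q. (g - q) mod n) (set ?Q)"
    proof (rule inj_onI, rule ccontr)
      fix u v assume uv: "u \<in> set ?Q" "v \<in> set ?Q" "u \<noteq> v" and "(g - u) mod n = (g - v) mod n"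
      then have "n dvd (g - u) - (g - v)" by (simp only: mod_eq_dvd_iff)
      moreover have "(g - u) - (g - v) = v - u" by simp
      ultimately show False using *[OF uv(2,1)] uv(3) by argo
    qed
    have "x \<noteq> 0" "y \<noteq> 0" "x + y \<noteq> 0" "2 * x - y \<noteq> 0" "2 * x + y \<noteq> 0" using nds by auto
    then have "distinct ?Q" using y(2) by auto
    then show "card (set ?Q) = 6" by (simp only: distinct_card) simp
  qed
  have gn: "g mod n = g" using g(1) rD by auto
  have xD: "x mod n \<in> ?D" "y mod n \<in> ?D" unfolding sym_residues_def using x y(1) by auto
  have gD: "g mod n \<in> ?D" using gn g(1) by simp
  have gx: "(g - x) mod n \<in> ?D" using D_diff xD gD by blast
  have gxx: "(g - x - x) mod n \<in> ?D" using D_diff xD gx by blast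
  have gy: "(g - y) mod n \<in> ?D" using D_diff xD gD by blast
  have gyy: "(g - y - y) mod n \<in> ?D" using D_diff xD gy by blast
  have gxxy: "(g - x - x - y) mod n \<in> ?D" using D_diff xD gxx by blast
  have gxxyy: "(g - x - x - y - y) mod n \<in> ?D" using D_diff xD gxxy by blast
  have "g - 2 * x = g - x - x" "g - 2 * y = g - y - y" "g - (2 * x + y) = g - x - x - y"
    "g - (2 * x + 2 * y) = g - x - x - y - y" by simp_all
  then have GD: "?G \<subseteq> ?D" using gD gxx gy gyy gxxy gxxyy by (simp add: diff_diff_eq[symmetric])
  have CD: "?C \<subseteq> ?D" using WD unfolding double_sums_mod_def by auto
  have disj: "?C \<inter> ?G = {}"
  proof (rule ccontr)
    assume "?C \<inter> ?G \<noteq> {}"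
    then obtain v where v: "v \<in> ?C" "v \<in> ?G" by blast
    from v(2) obtain q where q: "q \<in> set ?Q" "v = (g - q) mod n" by (rule imageE)
    from v(1) obtain J where J: "J \<subseteq> ?Z" and "v = 2 * \<Sum>J mod n"
      unfolding double_sums_mod_def by blast
    then have e: "2 * \<Sum>J mod n = (g - q) mod n" using q(2) by (simp only:)
    have "(2 * \<Sum>J + q) mod n = ((2 * \<Sum>J mod n) + q) mod n" by (simp add: mod_simps)
    also have "\<dots> = ((g - q) mod n + q) mod n" using e by simp
    also have "\<dots> = g mod n" by (simp add: mod_simps)
    also have "\<dots> = g" by (rule gn)
    finally have gJ: "g = (2 * \<Sum>J + q) mod n" by simp
    have fJ: "finite J" "x \<notin> J" "y \<notin> J" "J \<subseteq> X" using J X(1) finite_subset by auto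
    have "(2 * \<Sum>J + q) mod n \<in> ?W"
    proof -
      consider "q = 0" | "q = y" | "q = 2 * x" | "q = 2 * y" | "q = 2 * x + y" | "q = 2 * x + 2 * y"
        using q(1) by auto
      then show ?thesis
      proof cases
        case 1 then show ?thesis using W_I[of J 0] fJ by simp
      next
        case 2 then show ?thesis using W_I[of J y] fJ y by simp
      next
        case 3 then show ?thesis using W_I[of "insert x J" 0] fJ x by (simp add: algebra_simps)
      next
        case 4 then show ?thesis using W_I[of "insert y J" 0] fJ y by (simp add: algebra_simps)
      next
        case 5 then show ?thesis using W_I[of "insert x J" y] fJ x y by (simp add: algebra_simps)
      next
        case 6 then show ?thesis using W_I[of "insert x (insert y J)" 0] fJ x y by (simp add: algebra_simps)
      qed
    qed
    then show False using g gJ by simp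
  qed
  have fC: "finite ?C" using CD fD finite_subset by blast
  have "card (?C \<union> ?G) \<le> card ?D" using CD GD fD by (intro card_mono) auto
  then have "card ?C + card ?G \<le> 2 * ?m + 1"
    using card_Un_disjoint[OF fC _ disj] card_sym_residues[OF X] by simp
  moreover have "card ?G = 6" using card_image[OF distQ] cQ by simp
  moreover have "2 * card ?Z \<le> card ?C"
    using card_double_sums_mod_ge[OF n, of ?Z] X antisym_mod_subset[of n X ?Z] by auto
  moreover have "card ?Z = ?m - 2" using x y X(1) by (simp add: card_Diff_subset)
  ultimately show False using m by linarith
qed

subsection \<open>Signed sums omitting one element\<close>

text \<open>This is \<open>T(A)\<close>: \<open>j\<close> is the omitted element and
  \<open>I\<close> collects the elements with positive sign.\<close>

definition near_double_sums :: "int set \<Rightarrow> int set" where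
  "near_double_sums A = {2 * \<Sum>I + j | I j. j \<in> A \<and> I \<subseteq> A - {j}}"

lemma near_double_sumsI: "j \<in> A \<Longrightarrow> I \<subseteq> A - {j} \<Longrightarrow> 2 * \<Sum>I + j \<in> near_double_sums A"
  unfolding near_double_sums_def by blast

lemma near_double_sumsE:
  assumes "t \<in> near_double_sums A"
  obtains I j where "j \<in> A" "I \<subseteq> A - {j}" "t = 2 * \<Sum>I + j"
  using assms unfolding near_double_sums_def by blast

lemma near_double_sums_mono: "A \<subseteq> B \<Longrightarrow> near_double_sums A \<subseteq> near_double_sums B"
  unfolding near_double_sums_def by blast

lemma finite_near_double_sums:
  assumes "finite A" shows "finite (near_double_sums A)"
proof -
  have "near_double_sums A \<subseteq> (\<lambda>(I, j). 2 * \<Sum>I + j) ` (Pow A \<times> A)"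
    unfolding near_double_sums_def by auto
  then show ?thesis by (rule finite_subset) (use assms in simp)
qed

lemma near_double_sums_shift:
  assumes "finite A" "x \<notin> A" "t \<in> near_double_sums A"
  shows "t + 2 * x \<in> near_double_sums (insert x A)"
proof -
  obtain I j where I: "j \<in> A" "I \<subseteq> A - {j}" "t = 2 * \<Sum>I + j" using assms(3) by (rule near_double_sumsE)
  have "finite I" "x \<notin> I" using I assms(1,2) finite_subset by auto
  then have "t + 2 * x = 2 * \<Sum>(insert x I) + j" using I(3) by simp
  moreover have "insert x I \<subseteq> insert x A - {j}" using I(1,2) assms(2) by auto
  ultimately show ?thesis using near_double_sumsI[of j "insert x A" "insert x I"] I(1) by simp
qed

text \<open>Replacing \<open>I\<close> by its complement in \<open>A - {j}\<close> reverses all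
  signs, which is the reflection about \<open>\<Sum>A\<close>.\<close>

lemma near_double_sums_reflect:
  assumes "finite A" "t \<in> near_double_sums A"
  shows "2 * \<Sum>A - t \<in> near_double_sums A"
proof -
  obtain I j where I: "j \<in> A" "I \<subseteq> A - {j}" "t = 2 * \<Sum>I + j" using assms(2) by (rule near_double_sumsE)
  have "\<Sum>A = \<Sum>(A - {j}) + j" using assms(1) I(1) by (simp add: sum.remove)
  moreover have "\<Sum>(A - {j}) = \<Sum>(A - {j} - I) + \<Sum>I" using assms(1) I(2) by (simp add: sum.subset_diff)
  ultimately have "2 * \<Sum>A - t = 2 * \<Sum>(A - {j} - I) + j" using I(3) by simp
  then show ?thesis using near_double_sumsI[of j A "A - {j} - I"] I(1) by auto
qed

lemma near_double_sums_less:
  assumes "finite A" "\<forall>x\<in>A. 0 < x" "t \<in> near_double_sums A"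
  shows "t < 2 * \<Sum>A"
proof -
  obtain I j where I: "j \<in> A" "I \<subseteq> A - {j}" "t = 2 * \<Sum>I + j" using assms(3) by (rule near_double_sumsE)
  have "\<Sum>A = \<Sum>(A - {j}) + j" using assms(1) I(1) by (simp add: sum.remove)
  moreover have "\<Sum>I \<le> \<Sum>(A - {j})" using I(2) assms(1,2) by (intro sum_mono2) auto
  moreover have "0 < j" using assms(2) I(1) by blast
  ultimately show ?thesis using I(3) by simp
qed

text \<open>The largest element of each residue class of \<open>T\<close> lies outside \<open>T'\<close>.\<close>

lemma card_add_classes_le:
  fixes T T' :: "int set"
  assumes "finite T" "T' \<subseteq> T" "\<And>t. t \<in> T' \<Longrightarrow> t + d \<in> T" "d > 0"
  shows "card T' + card ((\<lambda>t. t mod d) ` T) \<le> card T"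
proof -
  let ?R = "(\<lambda>t. t mod d) ` T"
  define M where "M r = Max {t \<in> T. t mod d = r}" for r
  have M: "M r \<in> T \<and> M r mod d = r" if "r \<in> ?R" for r
  proof -
    have "M r \<in> {t \<in> T. t mod d = r}" unfolding M_def using that assms(1) by (intro Max_in) auto
    then show ?thesis by simp
  qed
  have ub: "t \<le> M r" if "t \<in> T" "t mod d = r" for t r
    unfolding M_def using that assms(1) by (intro Max_ge) auto
  have "M r \<notin> T'" if r: "r \<in> ?R" for r
  proof
    assume "M r \<in> T'"
    then have "M r + d \<in> T" by (rule assms(3))
    moreover have "(M r + d) mod d = r" using M[OF r] by simp
    ultimately have "M r + d \<le> M r" by (rule ub)
    then show False using assms(4) by simp
  qed
  then have "M ` ?R \<subseteq> T - T'" using M by blast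
  moreover have "inj_on M ?R" by (rule inj_onI) (metis M)
  ultimately have "card ?R \<le> card (T - T')" using assms(1) by (intro card_inj_on_le) auto
  then show ?thesis using assms(1,2) card_mono[OF assms(1,2)] by (simp add: card_Diff_subset finite_subset)
qed

section \<open>Residue classes met by near-double sums\<close>

lemma card_classes_ge_window:
  fixes T Q :: "int set"
  assumes "finite T" "Q \<subseteq> T" "\<And>q. q \<in> Q \<Longrightarrow> l \<le> q \<and> q < l + d"
  shows "card Q \<le> card ((\<lambda>t. t mod d) ` T)"
proof (rule card_inj_on_le)
  show "inj_on (\<lambda>t. t mod d) Q"
  proof (rule inj_onI)
    fix p q assume pq: "p \<in> Q" "q \<in> Q" and "p mod d = q mod d"
    then have "(p - l) mod d = (q - l) mod d" by (simp add: mod_eq_dvd_iff)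
    then show "p = q" using assms(3)[OF pq(1)] assms(3)[OF pq(2)] by simp
  qed
  show "(\<lambda>t. t mod d) ` Q \<subseteq> (\<lambda>t. t mod d) ` T" using assms(2) by blast
qed (use assms(1) in simp)

lemma near_double_sums_dilate_two:
  "near_double_sums ((*) 2 ` A) = (*) 2 ` near_double_sums A"
proof -
  have s: "\<Sum>((*) 2 ` I) = 2 * \<Sum>I" for I :: "int set"
    by (simp add: sum.reindex inj_on_def sum_distrib_left)
  show ?thesis
  proof (intro equalityI subsetI)
    fix t assume "t \<in> near_double_sums ((*) 2 ` A)"
    then obtain J j where J: "j \<in> A" "J \<subseteq> (*) 2 ` A - {2 * j}" "t = 2 * \<Sum>J + 2 * j"
      by (auto elim!: near_double_sumsE)
    then have "J \<subseteq> (*) 2 ` (A - {j})" by auto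
    then obtain I where I: "I \<subseteq> A - {j}" "J = (*) 2 ` I" by (meson subset_imageE)
    then have "t = 2 * (2 * \<Sum>I + j)" using J(3) s by simp
    then show "t \<in> (*) 2 ` near_double_sums A" using near_double_sumsI[OF J(1) I(1)] by blast
  next
    fix t assume "t \<in> (*) 2 ` near_double_sums A"
    then obtain I j where I: "j \<in> A" "I \<subseteq> A - {j}" "t = 2 * (2 * \<Sum>I + j)"
      by (auto elim!: near_double_sumsE)
    then have "t = 2 * \<Sum>((*) 2 ` I) + 2 * j" using s by simp
    moreover have "(*) 2 ` I \<subseteq> (*) 2 ` A - {2 * j}" using I(2) by auto
    ultimately show "t \<in> near_double_sums ((*) 2 ` A)"
      using near_double_sumsI[of "2 * j" "(*) 2 ` A" "(*) 2 ` I"] I(1) by auto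
  qed
qed

text \<open>The proof splits by parity. If some \<open>j\<close> has parity opposite to
  \<open>n\<close>, sums with at most one doubled element suffice: \<open>card X + 1\<close> of them
  omit \<open>n\<close> and \<open>card X\<close> omit \<open>j\<close>. If everything is odd,
  reduction modulo \<open>n\<close> leads to \<open>near_double_sums_mod\<close>. If everything is
  even, all elements are halved, and for this case the induction runs on \<open>n\<close>.\<close>

lemma card_classes_near_double_sums:
  assumes "finite X" "3 \<le> card X" "\<forall>x\<in>X. 0 < x \<and> x < n"
  shows "2 * card X + 1 \<le> card ((\<lambda>t. t mod (2 * n)) ` near_double_sums (insert n X))"
  using assms
proof (induction "nat n" arbitrary: n X rule: less_induct)
  case less
  note fX = less.prems(1) and cX = less.prems(2) and rX = less.prems(3)
  let ?T = "near_double_sums (insert n X)"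
  have fT: "finite ?T" using fX by (intro finite_near_double_sums) simp
  obtain x0 where "x0 \<in> X" using cX by fastforce
  then have n0: "0 < n" using rX by force
  have nX: "n \<notin> X" using rX by auto
  consider (mixed) j where "j \<in> X" "odd (n - j)" | (odd) "\<forall>j\<in>X. odd j" "odd n" | (even) "\<forall>j\<in>X. even j" "even n"
    by (cases "odd n") auto
  then show ?case
  proof cases
    case mixed
    let ?P = "(\<lambda>i. n + 2 * i) ` insert 0 X" and ?Q = "(\<lambda>i. j + 2 * i) ` insert 0 (X - {j})"
    have sub: "?P \<union> ?Q \<subseteq> ?T"
    proof -
      have "n + 2 * i \<in> ?T" if "i \<in> insert 0 X" for i
        using that near_double_sumsI[of n "insert n X" "{}"] near_double_sumsI[of n "insert n X" "{i}"] nX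
        by (auto simp: add.commute)
      moreover have "j + 2 * i \<in> ?T" if "i \<in> insert 0 (X - {j})" for i
        using that near_double_sumsI[of j "insert n X" "{}"] near_double_sumsI[of j "insert n X" "{i}"] mixed(1)
        by (auto simp: add.commute)
      ultimately show ?thesis by blast
    qed
    have form: "\<exists>u i. u \<in> {n, j} \<and> p = u + 2 * i \<and> 0 \<le> i \<and> i < n" if "p \<in> ?P \<union> ?Q" for p
    proof -
      have "0 \<le> i \<and> i < n" if "i \<in> insert 0 X" for i using that rX n0 by auto
      then show ?thesis using that by blast
    qed
    \<comment> \<open>Congruence modulo \<open>2 * n\<close> preserves parity, so the two sums omit
      the same element \<open>n\<close> or \<open>j\<close>. The doubled parts \<open>i1\<close> and
      \<open>i2\<close> are then congruent modulo \<open>n\<close> and both lie in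
      \<open>{0..<n}\<close>.\<close>
    have inj: "inj_on (\<lambda>t. t mod (2 * n)) (?P \<union> ?Q)"
    proof (rule inj_onI)
      fix p q assume pq: "p \<in> ?P \<union> ?Q" "q \<in> ?P \<union> ?Q" and "p mod (2 * n) = q mod (2 * n)"
      then have d: "2 * n dvd p - q" by (simp add: mod_eq_dvd_iff)
      then have ev: "even (p - q)" by (meson dvd_mult_left)
      have "\<exists>i1 i2. 0 \<le> i1 \<and> i1 < n \<and> 0 \<le> i2 \<and> i2 < n \<and> p - q = 2 * (i1 - i2)"
      proof -
        obtain u i1 where u: "u \<in> {n, j}" "p = u + 2 * i1" "0 \<le> i1 \<and> i1 < n"
          using form[OF pq(1)] by blast
        obtain v i2 where v: "v \<in> {n, j}" "q = v + 2 * i2" "0 \<le> i2 \<and> i2 < n"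
          using form[OF pq(2)] by blast
        have "even (u - v)" using ev u v by simp
        then have "u = v" using u v mixed(2) by auto
        then have "p - q = 2 * (i1 - i2)" using u v by simp
        then show ?thesis using u v by blast
      qed
      then obtain i1 i2 where i: "0 \<le> i1" "i1 < n" "0 \<le> i2" "i2 < n" "p - q = 2 * (i1 - i2)" by blast
      then have "2 * n dvd 2 * (i1 - i2)" using d by (simp only:)
      then have "n dvd i1 - i2" by (simp only: dvd_times_left_cancel_iff)
      then have "i1 mod n = i2 mod n" by (simp add: mod_eq_dvd_iff)
      then have "i1 = i2" using i by simp
      then show "p = q" using i by simp
    qed
    have dj: "?P \<inter> ?Q = {}"
    proof (rule ccontr)
      assume "?P \<inter> ?Q \<noteq> {}"
      then obtain u v where "n + 2 * u = j + 2 * v" by blast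
      then have "n - j = 2 * (v - u)" by simp
      then show False using mixed(2) by simp
    qed
    have "card ?P = card X + 1"
    proof -
      have "0 \<notin> X" using rX by auto
      then show ?thesis using fX by (subst card_image) (auto simp: inj_on_def)
    qed
    moreover have "card ?Q = card X"
    proof -
      have "0 \<notin> X - {j}" using rX by auto
      then have "card (insert 0 (X - {j})) = Suc (card (X - {j}))" using fX by simp
      also have "\<dots> = card X" using card.remove[OF fX mixed(1)] by simp
      finally show ?thesis by (subst card_image) (auto simp: inj_on_def)
    qed
    ultimately have "card (?P \<union> ?Q) = 2 * card X + 1"
      using fX card_Un_disjoint[OF _ _ dj] by simp
    moreover have "card ((\<lambda>t. t mod (2 * n)) ` (?P \<union> ?Q)) \<le> card ((\<lambda>t. t mod (2 * n)) ` ?T)"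
      using sub fT by (intro card_mono image_mono finite_imageI)
    ultimately show ?thesis using card_image[OF inj] by simp
  next
    case odd
    have "antisym_mod n X" unfolding antisym_mod_def
    proof (intro ballI conjI impI)
      fix x y assume xy: "x \<in> X" "y \<in> X"
      then have b: "0 < x" "x < n" "0 < y" "y < n" using rX by auto
      show "\<not> n dvd x + y"
      proof
        assume "n dvd x + y"
        then obtain k where k: "x + y = n * k" by (elim dvdE)
        \<comment> \<open>The even number \<open>x + y\<close> lies strictly between 0 and
          \<open>2 * n\<close>, so as a multiple of \<open>n\<close> it would be the odd number
          \<open>n\<close>.\<close>
        have "even (n * k)" using xy odd(1) k[symmetric] by simp
        then have "even k" using odd(2) by simp
        moreover have "n * 0 < n * k" "n * k < n * 2" unfolding k[symmetric] using b by simp_all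
        then have "0 < k" "k < 2" using n0 by (simp_all only: mult_less_cancel_left_pos)
        then have "k = 1" by simp
        ultimately show False by simp
      qed
      assume "x \<noteq> y"
      show "\<not> n dvd x - y"
      proof
        assume "n dvd x - y"
        then have "x mod n = y mod n" by (simp add: mod_eq_dvd_iff)
        then show False using b \<open>x \<noteq> y\<close> by simp
      qed
    qed
    then have "2 * card X + 1 \<le> card (near_double_sums_mod n X)"
      using card_near_double_sums_mod_ge n0 odd(2) fX cX by blast
    also have "\<dots> \<le> card ((\<lambda>t. t mod n) ` (\<lambda>t. t mod (2 * n)) ` ?T)"
    proof (rule card_mono)
      show "near_double_sums_mod n X \<subseteq> (\<lambda>t. t mod n) ` (\<lambda>t. t mod (2 * n)) ` ?T"
      proof
        fix r assume "r \<in> near_double_sums_mod n X"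
        then obtain I j where I: "I \<subseteq> X" "j \<in> insert 0 (X - I)" "r = (2 * \<Sum>I + j) mod n"
          unfolding near_double_sums_mod_def by blast
        have "\<exists>t\<in>?T. r = t mod n"
        proof (cases "j = 0")
          case True
          \<comment> \<open>Omitting \<open>n\<close> itself realises \<open>j = 0\<close> modulo
            \<open>n\<close>.\<close>
          have "2 * \<Sum>I + n \<in> ?T" using I(1) nX by (intro near_double_sumsI) auto
          moreover have "r = (2 * \<Sum>I + n) mod n" using I(3) True by simp
          ultimately show ?thesis by blast
        next
          case False
          then have "2 * \<Sum>I + j \<in> ?T" using I by (intro near_double_sumsI) auto
          then show ?thesis using I(3) by blast
        qed
        then obtain t where t: "t \<in> ?T" "r = t mod n" by blast
        have "t mod (2 * n) mod n = t mod n" by (simp add: mod_mod_cancel)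
        then show "r \<in> (\<lambda>t. t mod n) ` (\<lambda>t. t mod (2 * n)) ` ?T" using t by (metis imageI)
      qed
    qed (use fT in simp)
    also have "\<dots> \<le> card ((\<lambda>t. t mod (2 * n)) ` ?T)" using fT by (intro card_image_le) simp
    finally show ?thesis .
  next
    case even
    define Z where "Z = (\<lambda>x. x div 2) ` X"
    have XZ: "X = (*) 2 ` Z" unfolding Z_def using even(1) by (force simp: image_image)
    have cZ: "card Z = card X" unfolding XZ by (simp add: card_image inj_on_def)
    obtain k where k: "n = 2 * k" using even(2) by blast
    have "2 * card Z + 1 \<le> card ((\<lambda>t. t mod (2 * k)) ` near_double_sums (insert k Z))"
    proof (rule less.hyps)
      show "nat k < nat n" using k n0 by simp
      show "finite Z" unfolding Z_def using fX by simp
      show "3 \<le> card Z" using cZ cX by simp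
      show "\<forall>x\<in>Z. 0 < x \<and> x < k" using rX unfolding XZ k by auto
    qed
    also have "\<dots> = card ((*) 2 ` (\<lambda>t. t mod (2 * k)) ` near_double_sums (insert k Z))"
      by (simp add: card_image inj_on_def)
    also have "(*) 2 ` (\<lambda>t. t mod (2 * k)) ` near_double_sums (insert k Z)
        = (\<lambda>t. t mod (2 * n)) ` (*) 2 ` near_double_sums (insert k Z)"
      by (simp add: image_image k mult_mod_right)
    also have "(*) 2 ` near_double_sums (insert k Z) = ?T"
      by (simp add: near_double_sums_dilate_two[symmetric] k XZ)
    finally show ?thesis using cZ by simp
  qed
qed

lemma card_near_double_sums_insert:
  assumes "finite X" "3 \<le> card X" "\<forall>x\<in>X. 0 < x \<and> x < n"
  shows "card (near_double_sums X) + (2 * card X + 1) \<le> card (near_double_sums (insert n X))"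
proof -
  have "X \<noteq> {}" using assms(2) by auto
  then have n: "0 < n" "n \<notin> X" using assms(3) by force+
  have "card (near_double_sums X) + card ((\<lambda>t. t mod (2 * n)) ` near_double_sums (insert n X))
     \<le> card (near_double_sums (insert n X))"
    using n assms(1) near_double_sums_shift[OF assms(1) n(2)] near_double_sums_mono[of X "insert n X"]
    by (intro card_add_classes_le finite_near_double_sums) auto
  then show ?thesis using card_classes_near_double_sums[OF assms] by linarith
qed

subsection \<open>Progressions of odd multiples\<close>

definition odd_progression :: "int \<Rightarrow> nat \<Rightarrow> int set" where
  "odd_progression c m = (\<lambda>i. c * (2 * int i - 1)) ` {1..m}"

lemma odd_progression_Suc:
  "odd_progression c (Suc m) = insert (c * (2 * int m + 1)) (odd_progression c m)"
  unfolding odd_progression_def by (simp add: atLeastAtMostSuc_conv algebra_simps)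

lemma odd_progressionI: "1 \<le> i \<Longrightarrow> i \<le> m \<Longrightarrow> c * (2 * int i - 1) \<in> odd_progression c m"
  unfolding odd_progression_def by (rule imageI) simp

lemma finite_odd_progression: "finite (odd_progression c m)"
  unfolding odd_progression_def by simp

lemma card_odd_progression: "c > 0 \<Longrightarrow> card (odd_progression c m) = m"
  unfolding odd_progression_def by (subst card_image) (auto simp: inj_on_def)

lemma odd_progression_bounds:
  assumes "c > 0" "y \<in> odd_progression c m"
  shows "0 < y" "y \<le> c * (2 * int m - 1)"
proof -
  obtain i where "1 \<le> i" "i \<le> m" "y = c * (2 * int i - 1)"
    using assms(2) unfolding odd_progression_def by auto
  then show "0 < y" "y \<le> c * (2 * int m - 1)" using assms(1) by auto
qed

lemma odd_progression_3: "odd_progression c 3 = {c, 3 * c, 5 * c}"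
  by (simp add: numeral_3_eq_3 odd_progression_Suc) (auto simp: odd_progression_def)

lemma near_double_sums_subset_odd_multiples:
  assumes "t \<in> near_double_sums (odd_progression c m)"
  shows "\<exists>u. t = c * (2 * u + 1)"
proof -
  let ?A = "odd_progression c m"
  obtain I j where I: "j \<in> ?A" "I \<subseteq> ?A - {j}" "t = 2 * \<Sum>I + j" using assms by (rule near_double_sumsE)
  have "c dvd \<Sum>I" using I(2) unfolding odd_progression_def by (intro dvd_sum) auto
  then obtain w where w: "\<Sum>I = c * w" by (elim dvdE)
  obtain i where "j = c * (2 * int i - 1)" using I(1) unfolding odd_progression_def by auto
  then have "t = c * (2 * (w + int i - 1) + 1)" using I(3) w by (simp add: algebra_simps)
  then show ?thesis by blast
qed

text \<open>The sum \<open>?a j + 2 * ?a i\<close> has index \<open>2 * i + j - 1\<close>, so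
  \<open>j = 1\<close> yields even indices and \<open>j = 2\<close> odd ones, as long as
  \<open>i\<close> and \<open>j\<close> differ. With three terms the multiple \<open>9 * c\<close>
  would be missing.\<close>

lemma odd_multiples_in_near_double_sums:
  assumes c: "c > 0" and m: "4 \<le> m" and t: "1 \<le> t" "t \<le> 2 * m + 2"
  shows "c * (2 * int t - 1) \<in> near_double_sums (odd_progression c m)"
proof -
  let ?a = "\<lambda>i. c * (2 * int i - 1)"
  have single: "?a i \<in> near_double_sums (odd_progression c m)" if "1 \<le> i" "i \<le> m" for i
    using near_double_sumsI[of "?a i" "odd_progression c m" "{}"] odd_progressionI[OF that] by simp
  have pair: "?a j + 2 * ?a i \<in> near_double_sums (odd_progression c m)"
    if "1 \<le> i" "i \<le> m" "1 \<le> j" "j \<le> m" "i \<noteq> j" for i j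
  proof -
    have "?a i \<noteq> ?a j" using c that(5) by simp
    then show ?thesis
      using near_double_sumsI[of "?a j" "odd_progression c m" "{?a i}"]
        odd_progressionI[OF that(1,2)] odd_progressionI[OF that(3,4)] by (simp add: add.commute)
  qed
  \<comment> \<open>By that scheme index 5 would need \<open>i = j = 2\<close>, and index
    \<open>2 * m + 2\<close> would need \<open>i = m + 1\<close>. They are obtained from
    \<open>(i, j) = (1, 4)\<close> and \<open>(m, 3)\<close> instead.\<close>
  consider "t \<le> m" | "t = 5" | "t = 2 * m + 2" | i where "t = 2 * i" "2 \<le> i" "i \<le> m"
    | i where "t = 2 * i + 1" "2 < i" "i \<le> m"
  proof -
    assume h: "t \<le> m \<Longrightarrow> thesis" "t = 5 \<Longrightarrow> thesis" "t = 2 * m + 2 \<Longrightarrow> thesis"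
      "\<And>i. t = 2 * i \<Longrightarrow> 2 \<le> i \<Longrightarrow> i \<le> m \<Longrightarrow> thesis" "\<And>i. t = 2 * i + 1 \<Longrightarrow> 2 < i \<Longrightarrow> i \<le> m \<Longrightarrow> thesis"
    show thesis
    proof (cases "t \<le> m \<or> t = 5 \<or> t = 2 * m + 2")
      case True then show ?thesis using h by blast
    next
      case False
      show ?thesis
      proof (cases "even t")
        case True then obtain i where "t = 2 * i" by blast
        then show ?thesis using h(4)[of i] False m t by auto
      next
        case odd: False
        then obtain i where i: "t = 2 * i + 1" using oddE by blast
        then have "2 < i" "i \<le> m" using False m t by auto
        then show ?thesis using h(5) i by blast
      qed
    qed
  qed
  then show ?thesis
  proof cases
    case 1 then show ?thesis using single t by blast
  next
    case 2 then show ?thesis using pair[of 1 4] m by (simp add: algebra_simps)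
  next
    case 3 then show ?thesis using pair[of m 3] m by (simp add: algebra_simps)
  next
    case (4 i) then show ?thesis using pair[of i 1] m by (simp add: algebra_simps)
  next
    case (5 i) then show ?thesis using pair[of i 2] m by (simp add: algebra_simps)
  qed
qed

text \<open>The new sums are of two kinds. Those omitting \<open>x\<close> are not odd multiples of
  \<open>c\<close>, unlike all old sums; those in which \<open>x\<close> is doubled and one of
  \<open>c, 3 * c, 5 * c\<close> is subtracted exceed every old sum. A coincidence between the kinds
  would make \<open>x\<close> an odd multiple of \<open>c\<close>. The gain is two more than the
  general \<open>2 * m + 1\<close>, which is what \<open>m = 3\<close> requires.\<close>

lemma card_near_double_sums_insert_off_progression:
  assumes c: "c > 0" and m: "3 \<le> m" and x: "c * (2 * int m - 1) < x"
    and off: "\<nexists>u. x = c * (2 * u + 1)"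
  shows "card (near_double_sums (odd_progression c m)) + 2 * m + 3
    \<le> card (near_double_sums (insert x (odd_progression c m)))"
proof -
  let ?A = "odd_progression c m" and ?M = "c * (2 * int m - 1)"
  let ?T = "near_double_sums (insert x ?A)"
  \<comment> \<open>These are the sums over the empty set, over single elements, and over pairs
    containing the maximum. The pair sums exceed \<open>?M\<close>, so there are
    \<open>1 + m + (m - 1)\<close> different values.\<close>
  let ?S = "insert 0 (?A \<union> (+) ?M ` (?A - {?M}))"
  let ?F = "(\<lambda>s. 2 * s + x) ` ?S"
  let ?E = "(\<lambda>a. 2 * x + (2 * \<Sum>?A - a)) ` odd_progression c 3"
  have fA: "finite ?A" by (rule finite_odd_progression)
  have bA: "0 < y \<and> y \<le> ?M" if "y \<in> ?A" for y using odd_progression_bounds[OF c that] by simp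
  have xA: "x \<notin> ?A" using bA x by force
  have MA: "?M \<in> ?A" using odd_progressionI[of m m c] m by simp
  have cA: "card ?A = m" using card_odd_progression[OF c] .
  have sub3: "odd_progression c 3 \<subseteq> ?A" unfolding odd_progression_def using m by auto
  have x0: "0 < x" using bA[OF MA] x by simp
  have "?F \<subseteq> ?T"
  proof
    fix f assume "f \<in> ?F"
    then obtain s where s: "s \<in> ?S" "f = 2 * s + x" by blast
    from s(1) consider "s = 0" | "s \<in> ?A" | y where "y \<in> ?A" "y \<noteq> ?M" "s = ?M + y" by blast
    then obtain I where I: "I \<subseteq> ?A" "s = \<Sum>I"
    proof cases
      case 1 then show ?thesis using that[of "{}"] by simp
    next
      case 2 then show ?thesis using that[of "{s}"] by simp
    next
      case (3 y) then show ?thesis using that[of "{?M, y}"] MA by simp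
    qed
    then show "f \<in> ?T" using near_double_sumsI[of x "insert x ?A" I] s(2) xA by auto
  qed
  have "?E \<subseteq> ?T"
  proof
    fix e assume "e \<in> ?E"
    then obtain a where a: "a \<in> odd_progression c 3" "e = 2 * x + (2 * \<Sum>?A - a)" by blast
    then have aA: "a \<in> ?A" using sub3 by blast
    have "a \<in> near_double_sums ?A" using near_double_sumsI[of a ?A "{}"] aA by simp
    then have "2 * \<Sum>?A - a \<in> near_double_sums ?A" using near_double_sums_reflect[OF fA] by blast
    then show "e \<in> ?T" using near_double_sums_shift[OF fA xA] a(2) by (metis add.commute)
  qed
  have cF: "card ?F = 2 * m"
  proof -
    have "?A \<inter> (+) ?M ` (?A - {?M}) = {}"
    proof (rule ccontr)
      assume "?A \<inter> (+) ?M ` (?A - {?M}) \<noteq> {}"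
      then obtain y z where "y \<in> ?A" "z \<in> ?A" "z = ?M + y" by blast
      then show False using bA[of y] bA[of z] by simp
    qed
    moreover have "card ((+) ?M ` (?A - {?M})) = m - 1" using cA MA fA by (subst card_image) auto
    ultimately have "card (?A \<union> (+) ?M ` (?A - {?M})) = m + (m - 1)" using fA cA by (simp add: card_Un_disjoint)
    moreover have "0 \<notin> ?A \<union> (+) ?M ` (?A - {?M})" using bA bA[OF MA] by force
    ultimately have "card ?S = 2 * m" using fA m by simp
    then show ?thesis by (subst card_image) (auto simp: inj_on_def)
  qed
  have cE: "card ?E = 3" using card_odd_progression[OF c, of 3] by (subst card_image) (auto simp: inj_on_def)
  have TE: "near_double_sums ?A \<inter> ?E = {}"
  proof (rule ccontr)
    assume "near_double_sums ?A \<inter> ?E \<noteq> {}"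
    then obtain a where a: "a \<in> odd_progression c 3" "2 * x + (2 * \<Sum>?A - a) \<in> near_double_sums ?A" by blast
    then have "2 * x + (2 * \<Sum>?A - a) < 2 * \<Sum>?A" using near_double_sums_less[OF fA] bA by blast
    moreover have "a \<le> ?M" using a(1) sub3 bA by blast
    ultimately show False using x x0 by simp
  qed
  have mult: "c dvd s" if "s \<in> ?S" for s using that unfolding odd_progression_def by auto
  have oddm: "\<exists>u. y = c * (2 * u + 1)" if "y \<in> near_double_sums ?A" for y
    using near_double_sums_subset_odd_multiples[OF that] .
  have TF: "near_double_sums ?A \<inter> ?F = {}"
  proof (rule ccontr)
    assume "near_double_sums ?A \<inter> ?F \<noteq> {}"
    then obtain s where s: "s \<in> ?S" "2 * s + x \<in> near_double_sums ?A" by blast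
    obtain u where u: "2 * s + x = c * (2 * u + 1)" using oddm[OF s(2)] by blast
    obtain w where w: "s = c * w" using mult[OF s(1)] by (elim dvdE)
    have "x = c * (2 * (u - w) + 1)" using u w by (simp add: algebra_simps)
    then show False using off by blast
  qed
  have EF: "?E \<inter> ?F = {}"
  proof (rule ccontr)
    assume "?E \<inter> ?F \<noteq> {}"
    then obtain v where v: "v \<in> ?E" "v \<in> ?F" by blast
    from v(1) obtain a where a: "a \<in> odd_progression c 3" "v = 2 * x + (2 * \<Sum>?A - a)" by (rule imageE)
    from v(2) obtain s where s': "v = 2 * s + x" "s \<in> ?S" by (rule imageE)
    have s: "s \<in> ?S" "a \<in> odd_progression c 3" "2 * s + x = 2 * x + (2 * \<Sum>?A - a)"
      using a s' by simp_all
    obtain w where w: "s = c * w" using mult[OF s(1)] by (elim dvdE)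
    obtain i where i: "a = c * (2 * int i - 1)" using s(2) unfolding odd_progression_def by auto
    have "c dvd \<Sum>?A" unfolding odd_progression_def by (intro dvd_sum) auto
    then obtain v where v: "\<Sum>?A = c * v" by (elim dvdE)
    have "x = 2 * s - 2 * \<Sum>?A + a" using s(3) by simp
    then have "x = c * (2 * (w - v + int i - 1) + 1)" unfolding w v i by (simp add: algebra_simps)
    then show False using off by blast
  qed
  have fin: "finite (near_double_sums ?A)" "finite ?E" "finite ?F"
    using fA finite_near_double_sums finite_odd_progression by auto
  have "card (near_double_sums ?A \<union> ?E \<union> ?F) = card (near_double_sums ?A) + 3 + 2 * m"
    using TE TF EF fin cE cF by (subst card_Un_disjoint, simp, simp, blast, subst card_Un_disjoint) auto
  moreover have "near_double_sums ?A \<union> ?E \<union> ?F \<subseteq> ?T"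
    using \<open>?F \<subseteq> ?T\<close> \<open>?E \<subseteq> ?T\<close> near_double_sums_mono[of ?A "insert x ?A"] by blast
  ultimately show ?thesis
    using card_mono[of ?T "near_double_sums ?A \<union> ?E \<union> ?F"] finite_near_double_sums[of "insert x ?A"] fA by simp
qed

text \<open>By reflection it suffices to count the sums below the centre \<open>a + b + d\<close>
  and double. Four are always there, and avoiding a fifth forces \<open>d = 2 * a + b\<close> and
  \<open>a + 2 * b = 2 * a + d\<close>. The progression \<open>{c, 3 * c, 5 * c}\<close> attains 8,
  which is less than the square 9, so the quadratic bound starts only at four elements.\<close>

lemma card_near_double_sums_three:
  assumes "card A = 3" "\<forall>x\<in>A. 0 < x"
  shows "8 \<le> card (near_double_sums A)"
    and "card (near_double_sums A) < 10 \<Longrightarrow> \<exists>c>0. A = odd_progression c 3"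
proof -
  have "\<exists>a b d. A = {a, b, d} \<and> a < b \<and> b < d"
  proof -
    obtain x y z where "A = {x, y, z}" "x \<noteq> y" "y \<noteq> z" "x \<noteq> z" using assms(1) by (auto simp: card_3_iff)
    then consider "A = {x, y, z}" "x < y" "y < z" | "A = {x, z, y}" "x < z" "z < y" | "A = {y, x, z}" "y < x" "x < z"
      | "A = {y, z, x}" "y < z" "z < x" | "A = {z, x, y}" "z < x" "x < y" | "A = {z, y, x}" "z < y" "y < x"
      by (metis insert_commute linorder_neqE)
    then show ?thesis by cases blast+
  qed
  then obtain a b d where A: "A = {a, b, d}" and o: "a < b" "b < d" by blast
  have a0: "0 < a" using assms(2) A by simp
  let ?T = "near_double_sums A" and ?s = "a + b + d"
  have fA: "finite A" using A by simp
  have fT: "finite ?T" using fA by (rule finite_near_double_sums)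
  have sA: "\<Sum>A = ?s" using A o by simp
  have el: "a \<in> ?T" "b \<in> ?T" "d \<in> ?T" "2 * a + b \<in> ?T" "2 * a + d \<in> ?T" "a + 2 * b \<in> ?T"
    using near_double_sumsI[of a A "{}"] near_double_sumsI[of b A "{}"] near_double_sumsI[of d A "{}"]
      near_double_sumsI[of b A "{a}"] near_double_sumsI[of d A "{a}"] near_double_sumsI[of a A "{b}"] A o
    by (auto simp: add.commute)
  have half: "2 * card P \<le> card ?T" if P: "P \<subseteq> ?T" "\<forall>p\<in>P. p < ?s" for P
  proof -
    let ?R = "(\<lambda>p. 2 * ?s - p) ` P"
    have fP: "finite P" using P(1) fT finite_subset by blast
    have "?R \<subseteq> ?T" using P(1) near_double_sums_reflect[OF fA] sA by auto
    moreover have "P \<inter> ?R = {}"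
    proof (rule ccontr)
      assume "P \<inter> ?R \<noteq> {}"
      then obtain p q where "p \<in> P" "q \<in> P" "p = 2 * ?s - q" by blast
      then show False using P(2)[rule_format, of p] P(2)[rule_format, of q] by simp
    qed
    moreover have "card ?R = card P" by (subst card_image) (auto simp: inj_on_def)
    ultimately show ?thesis using card_mono[OF fT, of "P \<union> ?R"] P(1) fP by (simp add: card_Un_disjoint)
  qed
  have "card {a, b, 2 * a + b, 2 * a + d} = 4" using a0 o by simp
  then show "8 \<le> card ?T" using half[of "{a, b, 2 * a + b, 2 * a + d}"] el a0 o by auto
  assume lt: "card ?T < 10"
  have d: "d = 2 * a + b"
  proof (rule ccontr)
    assume "d \<noteq> 2 * a + b"
    then have "card {a, b, d, 2 * a + b, 2 * a + d} = 5" using a0 o by simp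
    then show False using half[of "{a, b, d, 2 * a + b, 2 * a + d}"] el a0 o lt by auto
  qed
  have b: "a + 2 * b = 2 * a + d"
  proof (rule ccontr)
    assume "a + 2 * b \<noteq> 2 * a + d"
    then have "card {a, b, a + 2 * b, 2 * a + b, 2 * a + d} = 5" using a0 o by simp
    then show False using half[of "{a, b, a + 2 * b, 2 * a + b, 2 * a + d}"] el a0 o lt by auto
  qed
  have "b = 3 * a" "d = 5 * a" using b d by simp_all
  then show "\<exists>c>0. A = odd_progression c 3" using A a0 odd_progression_3 by auto
qed

text \<open>If \<open>x\<close> is not an odd multiple of \<open>c\<close>, the preceding estimate
  leaves room to spare. If it is one beyond the next term, an additional residue class modulo
  \<open>2 * x\<close> appears. For \<open>m = 3\<close> the old set has only 8 sums instead of 9,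
  so the cases are counted explicitly; this is also why \<open>IH\<close> assumes
  \<open>4 \<le> m\<close>.\<close>

lemma card_near_double_sums_insert_progression:
  assumes c: "c > 0" and m: "3 \<le> m" and x: "c * (2 * int m - 1) < x"
    and IH: "4 \<le> m \<Longrightarrow> m\<^sup>2 \<le> card (near_double_sums (odd_progression c m))"
  shows "(m + 1)\<^sup>2 \<le> card (near_double_sums (insert x (odd_progression c m)))"
    and "card (near_double_sums (insert x (odd_progression c m))) = (m + 1)\<^sup>2 \<Longrightarrow> x = c * (2 * int m + 1)"
proof -
  let ?A = "odd_progression c m"
  let ?T' = "near_double_sums ?A" and ?T = "near_double_sums (insert x ?A)"
  have fA: "finite ?A" by (rule finite_odd_progression)
  have cA: "card ?A = m" using card_odd_progression[OF c] .
  have bA: "0 < y \<and> y < x" if "y \<in> ?A" for y using odd_progression_bounds[OF c that] x by simp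
  have xA: "x \<notin> ?A" using bA by blast
  have "?A \<noteq> {}" using cA m by auto
  then have x0: "0 < x" using bA by (metis ex_in_conv less_trans)
  have fT: "finite ?T" using fA by (intro finite_near_double_sums) simp
  have T'T: "?T' \<subseteq> ?T" by (rule near_double_sums_mono) blast
  have classes: "card ?T' + card Q \<le> card ?T" if "Q \<subseteq> ?T" "\<And>q. q \<in> Q \<Longrightarrow> c \<le> q \<and> q < c + 2 * x" for Q
    using card_add_classes_le[OF fT T'T near_double_sums_shift[OF fA xA]] x0
      card_classes_ge_window[OF fT that] by force
  have T3: "8 \<le> card ?T'" if "m = 3"
    using card_near_double_sums_three(1)[of ?A] cA bA that by blast
  have m2: "(m + 1)\<^sup>2 = m\<^sup>2 + 2 * m + 1" by (simp add: power2_eq_square)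
  have main: "(m + 1)\<^sup>2 \<le> card ?T \<and> (x \<noteq> c * (2 * int m + 1) \<longrightarrow> (m + 1)\<^sup>2 < card ?T)"
  proof (cases "\<exists>u. x = c * (2 * u + 1)")
    case False
    then have ge: "card ?T' + 2 * m + 3 \<le> card ?T"
      by (rule card_near_double_sums_insert_off_progression[OF c m x])
    show ?thesis
    proof (cases "m = 3")
      case True then show ?thesis using T3 ge by simp
    next
      case False then show ?thesis using IH ge m m2 by simp
    qed
  next
    case True
    then obtain u where u: "x = c * (2 * u + 1)" by blast
    have "c * (2 * int m - 1) < c * (2 * u + 1)" using x u by simp
    then have um: "int m \<le> u" using c by simp
    show ?thesis
    proof (cases "m = 3")
      case False
      then have m4: "4 \<le> m" using m by simp
      have ge: "card ?T' + (2 * m + 1) \<le> card ?T"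
        using card_near_double_sums_insert[of ?A x] fA cA bA m by simp
      have "(m + 1)\<^sup>2 < card ?T" if ne: "x \<noteq> c * (2 * int m + 1)"
      proof -
        \<comment> \<open>As \<open>x\<close> is at least \<open>c * (2 * m + 3)\<close>, the window
          of length \<open>2 * x\<close> starting at \<open>c\<close> holds the first
          \<open>2 * m + 2\<close> odd multiples of \<open>c\<close>, one more than the general
          number of classes.\<close>
        let ?Q = "odd_progression c (2 * m + 2)"
        have um1: "int m + 1 \<le> u" using ne u um by (cases "u = int m") auto
        have "?Q \<subseteq> ?T"
          using odd_multiples_in_near_double_sums[OF c m4] T'T unfolding odd_progression_def by auto
        moreover have "c \<le> q \<and> q < c + 2 * x" if q: "q \<in> ?Q" for q
        proof -
          obtain i where i: "1 \<le> i" "i \<le> 2 * m + 2" "q = c * (2 * int i - 1)"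
            using q unfolding odd_progression_def by auto
          have "c * 1 \<le> c * (2 * int i - 1)" using c i(1) by (intro mult_left_mono) auto
          moreover have "c * (2 * int i - 1) < c * (1 + 2 * (2 * u + 1))"
            using c i(2) um1 by (intro mult_strict_left_mono) auto
          ultimately show ?thesis using i(3) u by (simp add: algebra_simps)
        qed
        ultimately have "card ?T' + card ?Q \<le> card ?T" by (rule classes)
        then show ?thesis using card_odd_progression[OF c, of "2 * m + 2"] IH[OF m4] m2 by simp
      qed
      then show ?thesis using ge IH[OF m4] m2 by auto
    next
      case m3: True
      have A: "?A = {c, 3 * c, 5 * c}" using m3 odd_progression_3 by simp
      have x5: "5 * c < x" using x m3 by simp
      \<comment> \<open>Up to \<open>17 * c\<close>, the only odd multiple of \<open>c\<close>
        absent from this list is \<open>9 * c\<close>.\<close>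
      have mem: "c \<in> ?T'" "3 * c \<in> ?T'" "5 * c \<in> ?T'" "7 * c \<in> ?T'" "11 * c \<in> ?T'" "13 * c \<in> ?T'"
        "15 * c \<in> ?T'" "17 * c \<in> ?T'"
        using c near_double_sumsI[of c ?A "{}"] near_double_sumsI[of "3 * c" ?A "{}"]
          near_double_sumsI[of "5 * c" ?A "{}"] near_double_sumsI[of "5 * c" ?A "{c}"]
          near_double_sumsI[of "5 * c" ?A "{3 * c}"] near_double_sumsI[of "5 * c" ?A "{c, 3 * c}"]
          near_double_sumsI[of "3 * c" ?A "{c, 5 * c}"] near_double_sumsI[of c ?A "{3 * c, 5 * c}"]
        unfolding A by simp_all
      then have memT: "c \<in> ?T" "3 * c \<in> ?T" "5 * c \<in> ?T" "7 * c \<in> ?T" "11 * c \<in> ?T" "13 * c \<in> ?T"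
        "15 * c \<in> ?T" "17 * c \<in> ?T" using T'T by blast+
      have memx: "x \<in> ?T" "2 * c + x \<in> ?T" "8 * c + x \<in> ?T" "16 * c + x \<in> ?T"
        using c x5 near_double_sumsI[of x "insert x ?A" "{}"] near_double_sumsI[of x "insert x ?A" "{c}"]
          near_double_sumsI[of x "insert x ?A" "{c, 3 * c}"] near_double_sumsI[of x "insert x ?A" "{3 * c, 5 * c}"]
        unfolding A by simp_all
      \<comment> \<open>Here \<open>u = 3\<close> means the next term of the progression, where 16
        sums are listed. Otherwise nine classes are needed to reach \<open>8 + 9 = 17\<close>; the
        ninth comes from \<open>x = 9 * c\<close> or from \<open>8 * c + x\<close>.\<close>
      consider "u = 3" | "u = 4" | "5 \<le> u" using um m3 by linarith
      then show ?thesis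
      proof cases
        case 1
        then have x7: "x = 7 * c" using u by simp
        let ?L = "{c, 3 * c, 5 * c, 7 * c, 9 * c, 11 * c, 13 * c, 15 * c, 17 * c, 19 * c, 21 * c, 23 * c,
            25 * c, 27 * c, 29 * c, 31 * c}"
        have "t + 14 * c \<in> ?T" if "t \<in> ?T'" for t using near_double_sums_shift[OF fA xA that] x7 by simp
        from mem(3,4,5,6,7,8)[THEN this]
        have "19 * c \<in> ?T" "21 * c \<in> ?T" "25 * c \<in> ?T" "27 * c \<in> ?T" "29 * c \<in> ?T" "31 * c \<in> ?T"
          by simp_all
        moreover have "9 * c \<in> ?T" "23 * c \<in> ?T" using memx(2,4) x7 by simp_all
        ultimately have "?L \<subseteq> ?T" using memT by simp
        moreover have "card ?L = 16" using c by simp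
        ultimately have "16 \<le> card ?T" using card_mono[OF fT, of ?L] by simp
        then show ?thesis using m3 x7 by simp
      next
        case 2
        then have x9: "x = 9 * c" using u by simp
        let ?Q = "{c, 3 * c, 5 * c, 7 * c, 9 * c, 11 * c, 13 * c, 15 * c, 17 * c}"
        have "?Q \<subseteq> ?T" using memT memx(1) x9 by simp
        moreover have "c \<le> q \<and> q < c + 2 * x" if "q \<in> ?Q" for q using that c x9 by auto
        ultimately have "card ?T' + card ?Q \<le> card ?T" by (rule classes)
        moreover have "card ?Q = 9" using c by simp
        ultimately show ?thesis using T3[OF m3] m3 by simp
      next
        case 3
        let ?Q = "{c, 3 * c, 5 * c, 7 * c, 11 * c, 13 * c, 15 * c, 17 * c, 8 * c + x}"
        have "c * 11 \<le> c * (2 * u + 1)" using c 3 by (intro mult_left_mono) auto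
        then have x11: "11 * c \<le> x" using u by simp
        have "?Q \<subseteq> ?T" using memT memx(3) by simp
        moreover have "c \<le> q \<and> q < c + 2 * x" if "q \<in> ?Q" for q using that c x11 by auto
        ultimately have "card ?T' + card ?Q \<le> card ?T" by (rule classes)
        moreover have "card ?Q = 9" using c x11 by simp
        ultimately show ?thesis using T3[OF m3] m3 by simp
      qed
    qed
  qed
  then show "(m + 1)\<^sup>2 \<le> card ?T" by blast
  show "card ?T = (m + 1)\<^sup>2 \<Longrightarrow> x = c * (2 * int m + 1)" using main by force
qed

text \<open>The increment \<open>2 * card B + 1\<close> is the difference of consecutive squares, so
  equality passes from \<open>A\<close> to \<open>B\<close>. At the entry from three elements,
  either \<open>B\<close> is a progression, or it has at least 10 sums and \<open>10 + 7\<close>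
  exceeds 16.\<close>

lemma card_near_double_sums_ge:
  assumes "4 \<le> card A" "\<forall>x\<in>A. 0 < x"
  shows "(card A)\<^sup>2 \<le> card (near_double_sums A) \<and>
    (card (near_double_sums A) = (card A)\<^sup>2 \<longrightarrow> (\<exists>c>0. A = odd_progression c (card A)))"
  using assms
proof (induction "card A" arbitrary: A rule: less_induct)
  case less
  have fA: "finite A" using less.prems(1) card.infinite by fastforce
  define x B where "x = Max A" and "B = A - {x}"
  have "A \<noteq> {}" using less.prems(1) by auto
  then have xA: "x \<in> A" and ub: "\<And>y. y \<in> A \<Longrightarrow> y \<le> x" unfolding x_def using fA by auto
  have AB: "A = insert x B" and xB: "x \<notin> B" and fB: "finite B" unfolding B_def using xA fA by auto
  have cAB: "card A = card B + 1" using AB xB fB by simp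
  have cB: "3 \<le> card B" using cAB less.prems(1) by simp
  have bB: "\<forall>y\<in>B. 0 < y \<and> y < x" using ub less.prems(2) AB xB by (metis insertCI order_le_less)
  have ge: "card (near_double_sums B) + (2 * card B + 1) \<le> card (near_double_sums A)"
    using card_near_double_sums_insert[OF fB cB bB] AB by simp
  have sq: "(card A)\<^sup>2 = (card B)\<^sup>2 + 2 * card B + 1" unfolding cAB by (simp add: power2_eq_square)
  have IH: "(card B)\<^sup>2 \<le> card (near_double_sums B) \<and>
    (card (near_double_sums B) = (card B)\<^sup>2 \<longrightarrow> (\<exists>c>0. B = odd_progression c (card B)))" if "4 \<le> card B"
    using less.hyps[of B] that cAB bB by simp
  have ext: ?case if c: "c > 0" and B: "B = odd_progression c (card B)" for c
  proof -
    have m: "3 \<le> card B" by (rule cB)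
    have "c * (2 * int (card B) - 1) \<in> B" using odd_progressionI[of "card B" "card B" c] B cB by simp
    then have x: "c * (2 * int (card B) - 1) < x" using bB by blast
    have ih: "4 \<le> card B \<Longrightarrow> (card B)\<^sup>2 \<le> card (near_double_sums (odd_progression c (card B)))"
      using IH B by simp
    note E = card_near_double_sums_insert_progression[OF c m x ih]
    have AE: "insert x (odd_progression c (card B)) = A" using AB B by simp
    have "A = odd_progression c (card A)" if "card (near_double_sums A) = (card A)\<^sup>2"
    proof -
      have "x = c * (2 * int (card B) + 1)" using E(2) that unfolding AE cAB by simp
      then have "insert x (odd_progression c (card B)) = odd_progression c (Suc (card B))"
        using odd_progression_Suc by simp
      then show ?thesis using AE cAB by simp
    qed
    then show ?case using E(1) c unfolding AE cAB by blast
  qed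
  show ?case
  proof (cases "card B = 3")
    case True
    show ?thesis
    proof (cases "card (near_double_sums B) < 10")
      case lt: True
      then obtain c where "c > 0" "B = odd_progression c 3"
        using card_near_double_sums_three(2)[OF True _ lt] bB by blast
      then show ?thesis using ext True by simp
    next
      case False then show ?thesis using ge sq True by simp
    qed
  next
    case False
    then have B4: "4 \<le> card B" using cB by simp
    show ?thesis
    proof (cases "card (near_double_sums B) = (card B)\<^sup>2")
      case True
      then obtain c where "c > 0" "B = odd_progression c (card B)" using IH[OF B4] by blast
      then show ?thesis by (rule ext)
    next
      case False
      then have "(card B)\<^sup>2 < card (near_double_sums B)" using IH[OF B4] by simp
      then show ?thesis using ge sq by simp
    qed
  qed
qed

subsection \<open>Restricted signed sumsets\<close>

text \<open>\<open>I\<close> and \<open>J\<close> are the sets where the coefficient is 1 and -1;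
  sums over pairs of disjoint sets are easier to modify than coefficient functions.\<close>

lemma restricted_signed_sumset_eq:
  assumes "finite A"
  shows "restricted_signed_sumset h A =
    {\<Sum>I - \<Sum>J | I J. I \<subseteq> A \<and> J \<subseteq> A \<and> I \<inter> J = {} \<and> card I + card J = h}" (is "_ = ?R")
proof (intro equalityI subsetI)
  fix s assume "s \<in> restricted_signed_sumset h A"
  then obtain l :: "int \<Rightarrow> int" where l: "\<forall>x\<in>A. l x \<in> {-1, 0, 1}" "(\<Sum>x\<in>A. \<bar>l x\<bar>) = int h"
    and s: "s = (\<Sum>x\<in>A. l x * x)" unfolding restricted_signed_sumset_def by blast
  let ?I = "{x \<in> A. l x = 1}" and ?J = "{x \<in> A. l x = -1}"
  have "s = (\<Sum>x\<in>A. (if l x = 1 then x else 0) - (if l x = -1 then x else 0))"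
    unfolding s using l(1) by (intro sum.cong) auto
  then have "s = \<Sum>?I - \<Sum>?J" using assms by (simp only: sum_subtractf sum.inter_filter)
  moreover have "int h = (\<Sum>x\<in>A. (if l x = 1 then 1 else 0) + (if l x = -1 then 1 else 0))"
    unfolding l(2)[symmetric] using l(1) by (intro sum.cong) auto
  then have "int h = int (card ?I) + int (card ?J)"
    using assms by (simp only: sum.distrib sum.inter_filter[symmetric]) simp
  then have "card ?I + card ?J = h" by linarith
  moreover have "?I \<subseteq> A" "?J \<subseteq> A" "?I \<inter> ?J = {}" by auto
  ultimately show "s \<in> ?R" by blast
next
  fix s assume "s \<in> ?R"
  then obtain I J where IJ: "I \<subseteq> A" "J \<subseteq> A" "I \<inter> J = {}" "card I + card J = h" "s = \<Sum>I - \<Sum>J" by blast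
  define l :: "int \<Rightarrow> int" where "l x = (if x \<in> I then 1 else 0) - (if x \<in> J then 1 else 0)" for x
  have I: "{x \<in> A. x \<in> I} = I" "{x \<in> A. x \<in> J} = J" using IJ by auto
  have "(\<Sum>x\<in>A. l x * x) = (\<Sum>x\<in>A. (if x \<in> I then x else 0) - (if x \<in> J then x else 0))"
    unfolding l_def using IJ(3) by (intro sum.cong) auto
  also have "\<dots> = s" using assms I IJ(5) by (simp only: sum_subtractf sum.inter_filter[symmetric])
  finally have "s = (\<Sum>x\<in>A. l x * x)" by simp
  moreover have "(\<Sum>x\<in>A. \<bar>l x\<bar>) = (\<Sum>x\<in>A. (if x \<in> I then 1 else 0) + (if x \<in> J then 1 else 0))"
    unfolding l_def using IJ(3) by (intro sum.cong) auto
  then have "(\<Sum>x\<in>A. \<bar>l x\<bar>) = int (card I) + int (card J)"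
    using assms I by (simp only: sum.distrib sum.inter_filter[symmetric]) simp
  then have "(\<Sum>x\<in>A. \<bar>l x\<bar>) = int h" using IJ(4) by linarith
  moreover have "\<forall>x\<in>A. l x \<in> {-1, 0, 1}" unfolding l_def by auto
  ultimately show "s \<in> restricted_signed_sumset h A" unfolding restricted_signed_sumset_def by blast
qed

lemma restricted_signed_sumsetI:
  assumes "finite A" "I \<subseteq> A" "J \<subseteq> A" "I \<inter> J = {}" "card I + card J = h"
  shows "\<Sum>I - \<Sum>J \<in> restricted_signed_sumset h A"
  unfolding restricted_signed_sumset_eq[OF assms(1)] using assms(2-) by blast

lemma restricted_signed_sumset_positiveI:
  assumes "finite A" "I \<subseteq> A" "card I = h"
  shows "\<Sum>I \<in> restricted_signed_sumset h A"
  using restricted_signed_sumsetI[OF assms(1,2), of "{}" h] assms(3) by simp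

lemma restricted_signed_sumsetE:
  assumes "finite A" "s \<in> restricted_signed_sumset h A"
  obtains I J where "I \<subseteq> A" "J \<subseteq> A" "I \<inter> J = {}" "card I + card J = h" "s = \<Sum>I - \<Sum>J"
  using assms(2) unfolding restricted_signed_sumset_eq[OF assms(1)] by blast

lemma finite_restricted_signed_sumset:
  assumes "finite A" shows "finite (restricted_signed_sumset h A)"
proof -
  have "restricted_signed_sumset h A \<subseteq> (\<lambda>(I, J). \<Sum>I - \<Sum>J) ` (Pow A \<times> Pow A)"
    unfolding restricted_signed_sumset_eq[OF assms] by auto
  then show ?thesis by (rule finite_subset) (use assms in simp)
qed

lemma restricted_signed_sumset_mono:
  assumes "finite B" "A \<subseteq> B"
  shows "restricted_signed_sumset h A \<subseteq> restricted_signed_sumset h B"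
proof -
  have "finite A" using assms finite_subset by blast
  then show ?thesis
    unfolding restricted_signed_sumset_eq[OF assms(1)] restricted_signed_sumset_eq[OF \<open>finite A\<close>]
    using assms(2) by blast
qed

lemma restricted_signed_sumset_minus:
  assumes "finite A" "s \<in> restricted_signed_sumset h A"
  shows "- s \<in> restricted_signed_sumset h A"
proof -
  obtain I J where IJ: "I \<subseteq> A" "J \<subseteq> A" "I \<inter> J = {}" "card I + card J = h" "s = \<Sum>I - \<Sum>J"
    using assms by (rule restricted_signed_sumsetE)
  then have "\<Sum>J - \<Sum>I \<in> restricted_signed_sumset h A"
    using assms(1) by (intro restricted_signed_sumsetI) auto
  then show ?thesis using IJ(5) by simp
qed

text \<open>Exactly one element \<open>j\<close> is left without sign, so \<open>J\<close> is the
  complement of \<open>I\<close> in \<open>A - {j}\<close> and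
  \<open>\<Sum>I - \<Sum>J = 2 * \<Sum>I + j - \<Sum>A\<close>.\<close>

lemma restricted_signed_sumset_eq_near_double_sums:
  assumes "finite A" "card A = h + 1"
  shows "restricted_signed_sumset h A = (\<lambda>t. t - \<Sum>A) ` near_double_sums A"
proof (intro equalityI subsetI)
  fix s assume "s \<in> restricted_signed_sumset h A"
  with assms(1) obtain I J where IJ: "I \<subseteq> A" "J \<subseteq> A" "I \<inter> J = {}" "card I + card J = h" "s = \<Sum>I - \<Sum>J"
    by (rule restricted_signed_sumsetE)
  have f: "finite I" "finite J" using IJ assms(1) finite_subset by auto
  then have "card (I \<union> J) = h" using IJ by (simp add: card_Un_disjoint)
  then have "card (A - (I \<union> J)) = 1" using assms IJ f by (simp add: card_Diff_subset)
  then obtain j where j: "A - (I \<union> J) = {j}" by (rule card_1_singletonE)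
  have "\<Sum>A = \<Sum>(A - (I \<union> J)) + \<Sum>(I \<union> J)" using IJ assms(1) by (intro sum.subset_diff) auto
  also have "\<dots> = j + (\<Sum>I + \<Sum>J)" using j f IJ(3) by (simp add: sum.union_disjoint)
  finally have "s = (2 * \<Sum>I + j) - \<Sum>A" using IJ(5) by simp
  moreover have "2 * \<Sum>I + j \<in> near_double_sums A" using j IJ(1) by (intro near_double_sumsI) auto
  ultimately show "s \<in> (\<lambda>t. t - \<Sum>A) ` near_double_sums A" by blast
next
  fix s assume "s \<in> (\<lambda>t. t - \<Sum>A) ` near_double_sums A"
  then obtain t where t: "t \<in> near_double_sums A" "s = t - \<Sum>A" by blast
  obtain I j where I: "j \<in> A" "I \<subseteq> A - {j}" "t = 2 * \<Sum>I + j" using t(1) by (rule near_double_sumsE)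
  let ?J = "A - {j} - I"
  have fI: "finite I" using I(2) assms(1) finite_subset by blast
  have "card ?J = card (A - {j}) - card I" using I(2) fI by (intro card_Diff_subset) auto
  moreover have "card I \<le> card (A - {j})" using I(2) assms(1) by (intro card_mono) auto
  ultimately have "card I + card ?J = h" using assms I(1) by simp
  then have "\<Sum>I - \<Sum>?J \<in> restricted_signed_sumset h A"
    using assms(1) I(2) by (intro restricted_signed_sumsetI) auto
  moreover have "\<Sum>A = \<Sum>(A - {j}) + j" using assms(1) I(1) by (simp add: sum.remove)
  moreover have "\<Sum>(A - {j}) = \<Sum>?J + \<Sum>I" using assms(1) I(2) by (intro sum.subset_diff) auto
  ultimately show "s \<in> restricted_signed_sumset h A" using t(2) I(3) by simp
qed

text \<open>Making all signs positive does not decrease a signed sum of positive numbers, so the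
  maximum over \<open>h\<close>-subsets bounds every signed sum.\<close>

lemma ex_max_restricted_sum:
  fixes B :: "int set"
  assumes "finite B" "\<forall>y\<in>B. 0 < y" "h \<le> card B"
  obtains R where "R \<subseteq> B" "card R = h" "\<And>s. s \<in> restricted_signed_sumset h B \<Longrightarrow> s \<le> \<Sum>R"
proof -
  let ?F = "{R. R \<subseteq> B \<and> card R = h}"
  have fF: "finite ?F" using assms(1) by simp
  obtain R0 where "R0 \<subseteq> B" "card R0 = h" using assms(3) obtain_subset_with_card_n by metis
  then have "?F \<noteq> {}" by blast
  then have "Max (sum id ` ?F) \<in> sum id ` ?F" using fF by (intro Max_in) auto
  then obtain R where R: "R \<in> ?F" "Max (sum id ` ?F) = sum id R" by blast
  have le: "\<Sum>Q \<le> \<Sum>R" if "Q \<in> ?F" for Q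
  proof -
    have "sum id Q \<le> Max (sum id ` ?F)" using that fF by (intro Max_ge) auto
    then show ?thesis using R(2) by (simp add: id_def)
  qed
  have "s \<le> \<Sum>R" if s: "s \<in> restricted_signed_sumset h B" for s
  proof -
    obtain I J where IJ: "I \<subseteq> B" "J \<subseteq> B" "I \<inter> J = {}" "card I + card J = h" "s = \<Sum>I - \<Sum>J"
      using assms(1) s by (rule restricted_signed_sumsetE)
    have f: "finite I" "finite J" using IJ assms(1) finite_subset by auto
    have "I \<union> J \<in> ?F" using IJ f by (simp add: card_Un_disjoint)
    then have "\<Sum>(I \<union> J) \<le> \<Sum>R" by (rule le)
    moreover have "\<Sum>(I \<union> J) = \<Sum>I + \<Sum>J" using f IJ(3) by (rule sum.union_disjoint)
    moreover have "0 \<le> \<Sum>J" using IJ(2) assms(2) by (intro sum_nonneg) (auto simp: less_imp_le)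
    ultimately show ?thesis using IJ(5) by simp
  qed
  then show ?thesis using that R(1) by blast
qed

text \<open>Both sumsets are symmetric about 0, so every new positive element brings its negative
  along, and positivity keeps the two halves disjoint.\<close>

lemma card_restricted_signed_sumset_extend:
  assumes "finite A" "B \<subseteq> A" "E \<subseteq> restricted_signed_sumset h A" "E \<inter> restricted_signed_sumset h B = {}"
    and pos: "\<forall>e\<in>E. 0 < e"
  shows "card (restricted_signed_sumset h B) + 2 * card E \<le> card (restricted_signed_sumset h A)"
proof -
  let ?S = "restricted_signed_sumset h A" and ?S' = "restricted_signed_sumset h B" and ?N = "uminus ` E"
  have fB: "finite B" using assms(1,2) finite_subset by blast
  have fS: "finite ?S" "finite ?S'" using finite_restricted_signed_sumset assms(1) fB by auto
  have fE: "finite E" using assms(3) fS finite_subset by blast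
  have NS: "?N \<subseteq> ?S" using assms(3) restricted_signed_sumset_minus[OF assms(1)] by blast
  have NS': "?N \<inter> ?S' = {}"
  proof (rule ccontr)
    assume "?N \<inter> ?S' \<noteq> {}"
    then obtain e where e: "e \<in> E" "- e \<in> ?S'" by blast
    then have "e \<in> ?S'" using restricted_signed_sumset_minus[OF fB e(2)] by simp
    then show False using e assms(4) by blast
  qed
  have EN: "E \<inter> ?N = {}"
  proof (rule ccontr)
    assume "E \<inter> ?N \<noteq> {}"
    then obtain e where "e \<in> E" "- e \<in> E" by blast
    then show False using pos[rule_format, of e] pos[rule_format, of "- e"] by simp
  qed
  have "card (E \<union> ?N) = card E + card ?N" using fE by (intro card_Un_disjoint EN) auto
  also have "card ?N = card E" by (simp add: card_image)
  finally have "card (E \<union> ?N) = 2 * card E" by simp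
  moreover have "card (?S' \<union> (E \<union> ?N)) = card ?S' + card (E \<union> ?N)"
    using fS fE assms(4) NS' by (intro card_Un_disjoint) auto
  moreover have "?S' \<union> (E \<union> ?N) \<subseteq> ?S"
    using assms(3) NS restricted_signed_sumset_mono[OF assms(1,2), of h] by blast
  ultimately show ?thesis using card_mono[OF fS(1), of "?S' \<union> (E \<union> ?N)"] by simp
qed

lemma sum_exchange:
  fixes R :: "int set"
  assumes "finite R" "r \<in> R" "x \<notin> R"
  shows "\<Sum>(insert x (R - {r})) = x + \<Sum>R - r" "card (insert x (R - {r})) = card R"
proof -
  show "\<Sum>(insert x (R - {r})) = x + \<Sum>R - r" using assms by (simp add: sum_diff1)
  show "card (insert x (R - {r})) = card R" using assms card.remove[OF assms(1,2)] by simp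
qed

lemma card_restricted_signed_sumset_insert:
  assumes fB: "finite B" and bB: "\<forall>y\<in>B. 0 < y \<and> y < x" and h: "h \<le> card B"
  shows "card (restricted_signed_sumset h B) + 2 * h \<le> card (restricted_signed_sumset h (insert x B))"
proof -
  obtain R where R: "R \<subseteq> B" "card R = h" "\<And>s. s \<in> restricted_signed_sumset h B \<Longrightarrow> s \<le> \<Sum>R"
    using ex_max_restricted_sum[OF fB _ h] bB by blast
  have fR: "finite R" using R(1) fB finite_subset by blast
  have xR: "x \<notin> R" using R(1) bB by blast
  let ?E = "(\<lambda>r. x + \<Sum>R - r) ` R"
  have "0 \<le> \<Sum>R" using R(1) bB by (intro sum_nonneg) (auto simp: less_imp_le)
  then have gt: "\<Sum>R < e \<and> 0 < e" if "e \<in> ?E" for e using that R(1) bB by force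
  have "?E \<subseteq> restricted_signed_sumset h (insert x B)"
  proof
    fix e assume "e \<in> ?E"
    then obtain r where r: "r \<in> R" "e = x + \<Sum>R - r" by blast
    have "\<Sum>(insert x (R - {r})) \<in> restricted_signed_sumset h (insert x B)"
      using fB R(1,2) sum_exchange(2)[OF fR r(1) xR] by (intro restricted_signed_sumset_positiveI) auto
    then show "e \<in> restricted_signed_sumset h (insert x B)" using sum_exchange(1)[OF fR r(1) xR] r(2) by simp
  qed
  moreover have "?E \<inter> restricted_signed_sumset h B = {}" using gt R(3) by force
  ultimately have "card (restricted_signed_sumset h B) + 2 * card ?E \<le> card (restricted_signed_sumset h (insert x B))"
    using fB gt by (intro card_restricted_signed_sumset_extend) auto
  moreover have "card ?E = h" using R(2) by (subst card_image) (auto simp: inj_on_def)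
  ultimately show ?thesis by simp
qed

text \<open>Besides the single exchanges there is one more new sum: \<open>?M\<close> is replaced by
  \<open>x\<close> and the least element \<open>r0\<close> of \<open>R\<close> by its predecessor
  \<open>r0 - 2 * c\<close>. It lies below all single exchanges, and it equals the old maximum
  \<open>\<Sum>R\<close> only if \<open>x\<close> is the next term. Otherwise it is above that
  maximum or outside the residue class of the old sums.\<close>

lemma card_restricted_signed_sumset_insert_off_progression:
  assumes c: "c > 0" and h: "2 \<le> h" "h < m" and x: "c * (2 * int m - 1) < x" "x \<noteq> c * (2 * int m + 1)"
  shows "card (restricted_signed_sumset h (odd_progression c m)) + 2 * h
    < card (restricted_signed_sumset h (insert x (odd_progression c m)))"
proof -
  let ?B = "odd_progression c m" and ?M = "c * (2 * int m - 1)"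
  let ?S' = "restricted_signed_sumset h ?B" and ?S = "restricted_signed_sumset h (insert x ?B)"
  have fB: "finite ?B" by (rule finite_odd_progression)
  have cB: "card ?B = m" by (rule card_odd_progression[OF c])
  have bB: "0 < y \<and> y \<le> ?M" if "y \<in> ?B" for y using odd_progression_bounds[OF c that] by simp
  have MB: "?M \<in> ?B" using odd_progressionI[of m m c] h by simp
  have xB: "x \<notin> ?B" using bB x(1) by force
  obtain R where R: "R \<subseteq> ?B" "card R = h" and Rmax: "\<And>s. s \<in> ?S' \<Longrightarrow> s \<le> \<Sum>R"
    using ex_max_restricted_sum[OF fB, of h] bB h cB by (metis less_imp_le)
  have fR: "finite R" using R(1) fB finite_subset by blast
  have xR: "x \<notin> R" using R(1) xB by blast
  \<comment> \<open>\<open>R\<close> is an upper segment of \<open>?B\<close>, since exchanging one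
    of its elements for a larger one outside would increase the maximal sum.\<close>
  have top: "y < r" if y: "y \<in> ?B - R" and r: "r \<in> R" for y r
  proof -
    have "\<Sum>(insert y (R - {r})) \<in> ?S'"
      using fB R y sum_exchange(2)[OF fR r, of y] by (intro restricted_signed_sumset_positiveI) auto
    then have "y + \<Sum>R - r \<le> \<Sum>R" using Rmax sum_exchange(1)[OF fR r, of y] y by force
    moreover have "y \<noteq> r" using y r by blast
    ultimately show ?thesis by simp
  qed
  have Rne: "R \<noteq> {}" using R(2) h by auto
  have MR: "?M \<in> R"
  proof (rule ccontr)
    assume "?M \<notin> R"
    then obtain r where "r \<in> R" "?M < r" using top[of ?M] MB Rne by blast
    then show False using bB R(1) by force
  qed
  define r0 where "r0 = Min R"
  have r0: "r0 \<in> R" "\<And>r. r \<in> R \<Longrightarrow> r0 \<le> r" unfolding r0_def using fR Rne by auto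
  \<comment> \<open>\<open>R\<close> has at least two elements, so the two replacements concern
    different elements and can be made together.\<close>
  have r0M: "r0 \<noteq> ?M"
  proof
    assume "r0 = ?M"
    then have "R \<subseteq> {?M}" using r0(2) R(1) bB by force
    then have "card R \<le> 1" using card_mono[of "{?M}" R] by simp
    then show False using R(2) h by simp
  qed
  have "\<not> ?B \<subseteq> R" using card_mono[OF fR, of ?B] cB R(2) h by auto
  then obtain y where y: "y \<in> ?B - R" by blast
  have "r0 \<in> ?B" using r0(1) R(1) by blast
  then obtain i where i: "1 \<le> i" "i \<le> m" "r0 = c * (2 * int i - 1)"
    unfolding odd_progression_def by auto
  \<comment> \<open>The element \<open>y\<close> left out of \<open>R\<close> lies below
    \<open>r0\<close>, so \<open>r0\<close> is not the first term and has a predecessor in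
    \<open>?B\<close>.\<close>
  have "i \<noteq> 1"
  proof
    assume "i = 1"
    then have "r0 = c" using i by simp
    moreover obtain k where "1 \<le> k" "y = c * (2 * int k - 1)" using y unfolding odd_progression_def by auto
    ultimately have "r0 \<le> y" using c by simp
    then show False using top[OF y r0(1)] by simp
  qed
  then have "c * (2 * int (i - 1) - 1) \<in> ?B" using i by (intro odd_progressionI) auto
  moreover have "c * (2 * int (i - 1) - 1) = r0 - 2 * c" using i by (simp add: of_nat_diff algebra_simps)
  ultimately have rB: "r0 - 2 * c \<in> ?B" by simp
  have rR: "r0 - 2 * c \<notin> R" using r0(2) c by force
  let ?R1 = "insert x (R - {?M})"
  let ?R2 = "insert (r0 - 2 * c) (?R1 - {r0})"
  let ?e = "x + \<Sum>R - ?M - 2 * c"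
  have f1: "finite ?R1" "r0 \<in> ?R1" "r0 - 2 * c \<notin> ?R1" using fR r0(1) r0M rR rB xB by auto
  have R2: "\<Sum>?R2 = ?e" "card ?R2 = h"
    using sum_exchange[OF fR MR xR] sum_exchange[OF f1] R(2) by simp_all
  have "?R2 \<subseteq> insert x ?B" using R(1) rB by auto
  then have eS: "?e \<in> ?S" using restricted_signed_sumset_positiveI[of "insert x ?B" ?R2 h] R2 fB by simp
  have "0 < \<Sum>?R2" using f1(1) bB R(1) rB x(1) bB[OF MB] by (intro sum_pos) auto
  then have e0: "0 < ?e" using R2(1) by simp
  have eS': "?e \<notin> ?S'"
  proof (cases "x < c * (2 * int m + 1)")
    case False
    then have "x - ?M - 2 * c > 0" using x(2) by (simp add: algebra_simps)
    then show ?thesis using Rmax by force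
  next
    case True
    text \<open>All elements of \<open>?S'\<close> are congruent to \<open>h c\<close> modulo \<open>2 c\<close>, while \<open>x\<close> lies strictly between
      consecutive odd multiples of \<open>c\<close>.\<close>
    have oddc: "\<exists>v. \<Sum>I = c * (2 * v + int (card I))" if "I \<subseteq> ?B" for I
    proof -
      have "finite I" using that fB finite_subset by blast
      then show ?thesis using that
      proof induction
        case empty then show ?case by (intro exI[of _ 0]) simp
      next
        case (insert z I)
        then obtain v where v: "\<Sum>I = c * (2 * v + int (card I))" by blast
        obtain k where "z = c * (2 * int k - 1)" using insert.prems unfolding odd_progression_def by auto
        then have "\<Sum>(insert z I) = c * (2 * (v + int k - 1) + int (card (insert z I)))"
          using v insert.hyps by (simp add: algebra_simps)
        then show ?case by blast
      qed
    qed
    show ?thesis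
    proof
      assume "?e \<in> ?S'"
      with fB obtain I J where IJ: "I \<subseteq> ?B" "J \<subseteq> ?B" "I \<inter> J = {}" "card I + card J = h" "?e = \<Sum>I - \<Sum>J"
        by (rule restricted_signed_sumsetE)
      obtain v where v: "\<Sum>I = c * (2 * v + int (card I))" using oddc[OF IJ(1)] by blast
      obtain w where w: "\<Sum>J = c * (2 * w + int (card J))" using oddc[OF IJ(2)] by blast
      obtain z where z: "\<Sum>R = c * (2 * z + int (card R))" using oddc[OF R(1)] by blast
      have cR: "int (card R) = int (card I) + int (card J)" using R(2) IJ(4) by simp
      \<comment> \<open>The cardinalities contribute
        \<open>card I - card J - card R = - 2 * card J\<close>, which is even, so the odd factor of
        \<open>?M\<close> survives.\<close>
      define u where "u = v - w - z + int m - int (card J)"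
      have "x = \<Sum>I - \<Sum>J - \<Sum>R + ?M + 2 * c" using IJ(5) by simp
      also have "\<dots> = c * (2 * u + 1)"
        unfolding v w z cR u_def by (simp add: algebra_simps)
      finally have xu: "x = c * (2 * u + 1)" .
      have "2 * int m - 1 < 2 * u + 1" "2 * u + 1 < 2 * int m + 1"
        using x(1) True c unfolding xu by (simp_all only: mult_less_cancel_left_pos)
      then show False by presburger
    qed
  qed
  let ?E = "insert ?e ((\<lambda>r. x + \<Sum>R - r) ` R)"
  have "0 \<le> \<Sum>R" using R(1) bB by (intro sum_nonneg) (auto simp: less_imp_le)
  have rM: "r \<le> ?M" if "r \<in> R" for r using that R(1) bB by blast
  then have gt: "\<Sum>R < e \<and> 0 < e" if "e \<in> (\<lambda>r. x + \<Sum>R - r) ` R" for e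
    using that x(1) \<open>0 \<le> \<Sum>R\<close> by force
  have "?E \<subseteq> ?S"
  proof -
    have "x + \<Sum>R - r \<in> ?S" if r: "r \<in> R" for r
    proof -
      have "\<Sum>(insert x (R - {r})) \<in> ?S"
        using fB R sum_exchange(2)[OF fR r xR] by (intro restricted_signed_sumset_positiveI) auto
      then show ?thesis using sum_exchange(1)[OF fR r xR] by simp
    qed
    then show ?thesis using eS by blast
  qed
  moreover have "?E \<inter> ?S' = {}" using gt Rmax eS' by force
  ultimately have "card ?S' + 2 * card ?E \<le> card ?S"
    using fB gt e0 by (intro card_restricted_signed_sumset_extend) auto
  moreover have "card ?E = h + 1"
  proof -
    have "?e \<notin> (\<lambda>r. x + \<Sum>R - r) ` R"
    proof
      assume "?e \<in> (\<lambda>r. x + \<Sum>R - r) ` R"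
      then obtain r where "r \<in> R" "?e = x + \<Sum>R - r" by (rule imageE)
      then show False using rM[of r] c by simp
    qed
    moreover have "card ((\<lambda>r. x + \<Sum>R - r) ` R) = h" using R(2) by (subst card_image) (auto simp: inj_on_def)
    ultimately show ?thesis using fR by simp
  qed
  ultimately show ?thesis by simp
qed

text \<open>At \<open>card A = h + 1\<close> the bound is \<open>(h + 1)^2\<close>, and
  \<open>h + 1\<close> is at least 4, so near-double sums settle this case. Each further element
  raises the bound by exactly \<open>2 * h\<close>; equality therefore descends to \<open>B\<close>,
  and the strict estimate for progressions leaves only one possible maximum.\<close>

lemma card_restricted_signed_sumset_ge:
  assumes "3 \<le> h" "h + 1 \<le> card A" "\<forall>x\<in>A. 0 < x"
  shows "2 * int h * int (card A) - (int h)\<^sup>2 + 1 \<le> int (card (restricted_signed_sumset h A)) \<and>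
    (int (card (restricted_signed_sumset h A)) = 2 * int h * int (card A) - (int h)\<^sup>2 + 1
      \<longrightarrow> (\<exists>c>0. A = odd_progression c (card A)))"
  using assms(2,3)
proof (induction "card A" arbitrary: A rule: less_induct)
  case less
  have fA: "finite A" using less.prems(1) card.infinite by fastforce
  show ?case
  proof (cases "card A = h + 1")
    case True
    have "card (restricted_signed_sumset h A) = card (near_double_sums A)"
      unfolding restricted_signed_sumset_eq_near_double_sums[OF fA True]
      by (subst card_image) (auto simp: inj_on_def)
    moreover have "2 * int h * int (card A) - (int h)\<^sup>2 + 1 = int ((card A)\<^sup>2)"
      unfolding True by (simp add: power2_eq_square algebra_simps)
    moreover have "4 \<le> card A" using True assms(1) by simp
    ultimately show ?thesis using card_near_double_sums_ge[of A] less.prems(2) by simp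
  next
    case False
    define x B where "x = Max A" and "B = A - {x}"
    have "A \<noteq> {}" using less.prems(1) by auto
    then have xA: "x \<in> A" and ub: "\<And>y. y \<in> A \<Longrightarrow> y \<le> x" unfolding x_def using fA by auto
    have AB: "A = insert x B" and xB: "x \<notin> B" and fB: "finite B" unfolding B_def using xA fA by auto
    have cAB: "card A = card B + 1" using AB xB fB by simp
    have cB: "h + 1 \<le> card B" using cAB less.prems(1) False by simp
    have bB: "\<forall>y\<in>B. 0 < y \<and> y < x" using ub less.prems(2) AB xB by (metis insertCI order_le_less)
    have step: "card (restricted_signed_sumset h B) + 2 * h \<le> card (restricted_signed_sumset h A)"
      using card_restricted_signed_sumset_insert[OF fB bB, of h] cB AB by simp
    have eq: "2 * int h * int (card A) - (int h)\<^sup>2 + 1 = (2 * int h * int (card B) - (int h)\<^sup>2 + 1) + int (2 * h)"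
      unfolding cAB by (simp add: algebra_simps)
    have IH: "2 * int h * int (card B) - (int h)\<^sup>2 + 1 \<le> int (card (restricted_signed_sumset h B))"
      "int (card (restricted_signed_sumset h B)) = 2 * int h * int (card B) - (int h)\<^sup>2 + 1
        \<Longrightarrow> \<exists>c>0. B = odd_progression c (card B)"
      using less.hyps[of B] cAB cB bB by simp_all
    have ge: "2 * int h * int (card A) - (int h)\<^sup>2 + 1 \<le> int (card (restricted_signed_sumset h A))"
      using step IH(1) eq by linarith
    have "\<exists>c>0. A = odd_progression c (card A)"
      if tight: "int (card (restricted_signed_sumset h A)) = 2 * int h * int (card A) - (int h)\<^sup>2 + 1"
    proof -
      have "int (card (restricted_signed_sumset h B)) = 2 * int h * int (card B) - (int h)\<^sup>2 + 1"
        and no: "\<not> card (restricted_signed_sumset h B) + 2 * h < card (restricted_signed_sumset h A)"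
        using step IH(1) eq tight by linarith+
      then obtain c where c: "c > 0" "B = odd_progression c (card B)" using IH(2) by blast
      have "c * (2 * int (card B) - 1) \<in> B" using odd_progressionI[of "card B" "card B" c] c(2) cB by simp
      then have "c * (2 * int (card B) - 1) < x" using bB by blast
      then have "x = c * (2 * int (card B) + 1)"
        using card_restricted_signed_sumset_insert_off_progression[OF c(1), of h "card B" x]
          no cB assms(1) c(2) AB by force
      then have "A = odd_progression c (card A)"
        using AB c(2) odd_progression_Suc[of c "card B"] cAB by simp
      then show ?thesis using c(1) by blast
    qed
    then show ?thesis using ge by blast
  qed
qed

theorem theorem2:
  fixes h k :: nat and a :: "nat \<Rightarrow> int" and A :: "int set"
  assumes "0 < h" and "0 < k"
    and "3 \<le> h" and "h \<le> k - 1"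
    and "A = a ` {1..k}"
    and "\<forall>i\<in>{1..k}. 0 < a i"
    and "strict_mono_on {1..k} a"
    and "int (card (restricted_signed_sumset h A)) = 2 * int h * int k - (int h)\<^sup>2 + 1"
  shows "A = dilate (a 1) {2 * int i - 1 | i. i \<in> {1..k}}"
proof -
  have "inj_on a {1..k}" using assms(7) by (rule strict_mono_on_imp_inj_on)
  then have k: "card A = k" using assms(5) by (simp add: card_image)
  have "h + 1 \<le> card A" "\<forall>x\<in>A. 0 < x" using k assms(2,4,5,6) by auto
  then obtain c where c: "c > 0" "A = odd_progression c k"
    using card_restricted_signed_sumset_ge[OF assms(3), of A] assms(8) k by auto
  \<comment> \<open>The factor \<open>c\<close> is the least element of the progression and
    \<open>a 1\<close> the least value of \<open>a\<close>, so the two agree.\<close>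
  have "a 1 \<in> A" using assms(2,5) by auto
  then have "c \<le> a 1" using c unfolding odd_progression_def by auto
  moreover have "c \<in> A" using odd_progressionI[of 1 k c] assms(2) c(2) by simp
  then obtain i where i: "i \<in> {1..k}" "c = a i" using assms(5) by blast
  have "a 1 \<le> a i"
    using strict_mono_on_leD[OF assms(7), of 1 i] i(1) by simp
  ultimately have "a 1 = c" using i(2) by simp
  then show ?thesis using c(2) unfolding odd_progression_def dilate_def by auto
qed

end
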